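(* Let $p$ be a prime and let $k$ be a divisor of $p-1$ with $1\le k<p-1$; write $p-1=kn$. Let $\chi$ be any generator of the cyclic group $\widehat{\mathbb{F}_p^{\times}}$ of multiplicative characters of $\mathbb{F}_p$. Define $X_{p,\chi}(k)=\left[J_p(\chi^{ki},\chi^{kj})\right]_{1\le i,j\le n-1}$ and $Y_{p,\chi}(k)=\left[J_p(\chi^{ki},\chi^{kj})\right]_{0\le i,j\le n-1}$. Let $\zeta_p\in\mathbb{C}$ be a primitive $p$-th root of unity, $U_k(\mathbb{F}_p)=\{x\in\mathbb{F}_p^{\times}:x^k=1\}$, $\theta_k=\sum_{x\in U_k(\mathbb{F}_p)}\zeta_p^{x}$, and let $P_k(T)\in\mathbb{Z}[T]$ be the minimal polynomial of $\theta_k$ over $\mathbb{Q}$, with $x_p(k)$ the coefficient of $T$ and $y_p(k)$ the constant term of $P_k(T)$. Then $$\det\left[G_p(\chi^{ki+kj})\right]_{1\le i,j\le n-1}=(-1)^{\frac{k(n^2-n)}{2}}\cdot\det X_{p,\chi}(k)=(-1)^{\frac{n^2-n}{2}}\cdot n^{n-2}\cdot x_p(k),$$ and $$\det\left[G_p(\chi^{ki+kj})\right]_{0\le i,j\le n-1}=(-1)^{\frac{k(n^2-n)}{2}}\left(p\det Y_{p,\chi}(k)-(p-1)^2\det X_{p,\chi}(k)\right)=(-1)^{\frac{n^2-n+2}{2}}\cdot n^{n}\cdot y_p(k).$$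
   Context: Every multiplicative character $A:\mathbb{F}_p^{\times}\to\mathbb{C}^{\times}$ is extended to $\mathbb{F}_p$ by setting $A(0)=0$ (including the trivial character). The Gauss sum of $A$ is $G_p(A)=\sum_{x\in\mathbb{F}_p}A(x)\zeta_p^{x}$, and the Jacobi sum of $A,B$ is $J_p(A,B)=\sum_{x\in\mathbb{F}_p}A(x)B(1-x)$. In $\zeta_p^{x}$, $x\in\mathbb{F}_p$ is identified with an integer representative. *)

theory Defs
  imports
    "HOL-Algebra.Generated_Groups"
    "Berlekamp_Zassenhaus.Finite_Field"
    "Jordan_Normal_Form.Determinant"
    Complex_Main
begin

text \<open>The field with \<open>p\<close> elements is the type \<^typ>\<open>'p mod_ring\<close>, where the index type
  \<open>'p :: prime_card\<close> has prime cardinality \<open>p = CARD('p)\<close>.\<close>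

text \<open>A character of the multiplicative group is extended by \<open>0\<close> at \<open>0\<close>, the trivial one included;
  it therefore vanishes exactly at \<open>0\<close>.\<close>

definition mult_char :: "('p::prime_card mod_ring \<Rightarrow> complex) \<Rightarrow> bool" where
  "mult_char A \<longleftrightarrow>
     A 0 = 0 \<and>
     (\<forall>x. x \<noteq> 0 \<longrightarrow> A x \<noteq> 0) \<and>
     (\<forall>x y. x \<noteq> 0 \<longrightarrow> y \<noteq> 0 \<longrightarrow> A (x * y) = A x * A y)"

definition trivial_char :: "'p::prime_card mod_ring \<Rightarrow> complex" where
  "trivial_char x = (if x = 0 then 0 else 1)"

definition char_group :: "('p::prime_card mod_ring \<Rightarrow> complex) monoid" where
  "char_group =
     \<lparr>carrier = {A. mult_char A},
      monoid.mult = (\<lambda>A B x. A x * B x),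
      one = trivial_char\<rparr>"

lemma comm_group_char_group: "comm_group (char_group :: ('p::prime_card mod_ring \<Rightarrow> complex) monoid)"
proof (rule comm_groupI)
  fix A :: "'p mod_ring \<Rightarrow> complex"
  assume A: "A \<in> carrier char_group"
  have "(\<lambda>x. inverse (A x)) \<in> carrier char_group"
    using A by (auto simp: char_group_def mult_char_def)
  moreover have "(\<lambda>x. inverse (A x)) \<otimes>\<^bsub>char_group\<^esub> A = \<one>\<^bsub>char_group\<^esub>"
    using A by (auto simp: char_group_def mult_char_def trivial_char_def)
  ultimately show "\<exists>B\<in>carrier char_group. B \<otimes>\<^bsub>char_group\<^esub> A = \<one>\<^bsub>char_group\<^esub>"
    by blast
qed (auto simp: char_group_def mult_char_def trivial_char_def mult_ac fun_eq_iff)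

definition char_generator :: "('p::prime_card mod_ring \<Rightarrow> complex) \<Rightarrow> bool" where
  "char_generator \<chi> \<longleftrightarrow>
     \<chi> \<in> carrier char_group \<and> generate char_group {\<chi>} = carrier char_group"

text \<open>Powers are taken in the character group, so \<open>char_pow \<chi> 0\<close> is the trivial character and
  vanishes at \<open>0\<close>, unlike the pointwise power.\<close>

abbreviation char_pow :: "('p::prime_card mod_ring \<Rightarrow> complex) \<Rightarrow> nat \<Rightarrow> 'p mod_ring \<Rightarrow> complex" where
  "char_pow \<chi> m \<equiv> \<chi> [^]\<^bsub>char_group\<^esub> m"

lemma char_pow_eq: "char_pow \<chi> m = (\<lambda>x. if x = 0 then 0 else \<chi> x ^ m)" if "mult_char \<chi>"
  by (induction m)
     (use that in \<open>auto simp: char_group_def mult_char_def trivial_char_def fun_eq_iff\<close>)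

definition primitive_root_of_unity :: "nat \<Rightarrow> complex \<Rightarrow> bool" where
  "primitive_root_of_unity m z \<longleftrightarrow> z ^ m = 1 \<and> (\<forall>l. 0 < l \<longrightarrow> l < m \<longrightarrow> z ^ l \<noteq> 1)"

text \<open>The power of \<open>z\<close> at a residue class; \<^const>\<open>to_int_mod_ring\<close> picks the representative
  in \<open>{0..<p}\<close>.\<close>

definition root_pow :: "complex \<Rightarrow> 'p::prime_card mod_ring \<Rightarrow> complex" where
  "root_pow z x = z powi to_int_mod_ring x"

definition gauss_sum :: "complex \<Rightarrow> ('p::prime_card mod_ring \<Rightarrow> complex) \<Rightarrow> complex" where
  "gauss_sum z A = (\<Sum>x\<in>UNIV. A x * root_pow z x)"

definition jacobi_sum ::
  "('p::prime_card mod_ring \<Rightarrow> complex) \<Rightarrow> ('p mod_ring \<Rightarrow> complex) \<Rightarrow> complex" where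
  "jacobi_sum A B = (\<Sum>x\<in>UNIV. A x * B (1 - x))"

text \<open>Matrices of \<^typ>\<open>'a mat\<close> are indexed from \<open>0\<close>;
  \<open>mat_from_to a b f\<close> is \<open>[f i j]\<close> with \<open>a \<le> i, j \<le> b\<close>.\<close>

definition mat_from_to :: "nat \<Rightarrow> nat \<Rightarrow> (nat \<Rightarrow> nat \<Rightarrow> 'a) \<Rightarrow> 'a mat" where
  "mat_from_to a b f = mat (b + 1 - a) (b + 1 - a) (\<lambda>(i, j). f (a + i) (a + j))"

definition X_mat :: "('p::prime_card mod_ring \<Rightarrow> complex) \<Rightarrow> nat \<Rightarrow> nat \<Rightarrow> complex mat" where
  "X_mat \<chi> k n = mat_from_to 1 (n - 1) (\<lambda>i j. jacobi_sum (char_pow \<chi> (k * i)) (char_pow \<chi> (k * j)))"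

definition Y_mat :: "('p::prime_card mod_ring \<Rightarrow> complex) \<Rightarrow> nat \<Rightarrow> nat \<Rightarrow> complex mat" where
  "Y_mat \<chi> k n = mat_from_to 0 (n - 1) (\<lambda>i j. jacobi_sum (char_pow \<chi> (k * i)) (char_pow \<chi> (k * j)))"

definition roots_U :: "nat \<Rightarrow> 'p::prime_card mod_ring set" where
  "roots_U k = {x. x \<noteq> 0 \<and> x ^ k = 1}"

definition gauss_period :: "'p::prime_card itself \<Rightarrow> complex \<Rightarrow> nat \<Rightarrow> complex" where
  "gauss_period _ z k = (\<Sum>x\<in>(roots_U k :: 'p mod_ring set). root_pow z x)"

definition is_min_poly :: "rat poly \<Rightarrow> complex \<Rightarrow> bool" where
  "is_min_poly P z \<longleftrightarrow>
     lead_coeff P = 1 \<and> poly (map_poly of_rat P) z = 0 \<and>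
     (\<forall>Q. Q \<noteq> 0 \<longrightarrow> poly (map_poly of_rat Q) z = 0 \<longrightarrow> degree P \<le> degree Q)"

lemma is_min_poly_unique:
  assumes "is_min_poly P z" "is_min_poly Q z"
  shows "P = Q"
proof (rule ccontr)
  assume "P \<noteq> Q"
  then have ne: "P - Q \<noteq> 0" by simp
  have deg: "degree P = degree Q"
    using assms unfolding is_min_poly_def
    by (metis antisym_conv leading_coeff_0_iff zero_neq_one)
  have "map_poly of_rat (P - Q) = map_poly of_rat P - (map_poly of_rat Q :: complex poly)"
    by (intro poly_eqI) (simp add: coeff_map_poly of_rat_diff)
  then have "poly (map_poly of_rat (P - Q)) z = 0"
    using assms by (simp add: is_min_poly_def)
  then have "degree P \<le> degree (P - Q)"
    using ne assms(1) by (simp add: is_min_poly_def)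
  moreover have "degree (P - Q) \<le> degree P"
    using deg by (simp add: degree_diff_le)
  ultimately have "coeff (P - Q) (degree P) \<noteq> 0"
    using ne by (metis antisym leading_coeff_0_iff)
  then show False
    using assms deg by (simp add: is_min_poly_def)
qed

text \<open>The minimal polynomial over the rationals as an element of \<open>\<int>[T]\<close>. It is meaningful for
  algebraic integers only; that Gauss periods have an integral minimal polynomial is not
  built into the definition.\<close>

definition int_min_poly :: "complex \<Rightarrow> int poly" where
  "int_min_poly z = (THE P. is_min_poly (map_poly of_int P) z)"

definition period_poly :: "'p::prime_card itself \<Rightarrow> complex \<Rightarrow> nat \<Rightarrow> int poly" where
  "period_poly T z k = int_min_poly (gauss_period T z k)"

end

theory Submission
  imports
    Defs
    "HOL-Algebra.Multiplicative_Group"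
    "Jordan_Normal_Form.Char_Poly"
begin

text \<open>Let \<open>\<eta>\<^sub>t\<close> (\<open>t < n\<close>) be the Gauss periods over the cosets of \<open>U\<^sub>k\<close> and let \<open>\<omega>\<close> be the
  primitive \<open>n\<close>-th root of unity through which \<open>\<chi>\<^sup>k\<close> separates the cosets. Sorting a Gauss sum by
  cosets gives \<open>G(\<chi>\<^bsup>k(i + j)\<^esup>) = \<Sum>\<^sub>t \<omega>\<^bsup>it\<^esup> \<eta>\<^sub>t \<omega>\<^bsup>jt\<^esup>\<close>, so the matrix of Gauss sums is \<open>F D F\<close> with a
  Fourier matrix \<open>F\<close> and \<open>D = diag(\<eta>\<^sub>t)\<close>. Its determinant is \<open>(det F)\<^sup>2 \<Prod> \<eta>\<^sub>t\<close>, and its minor at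
  \<open>(0, 0)\<close> is read off the inverse \<open>n\<^bsup>-2\<^esup> F' D\<^bsup>-1\<^esup> F'\<close>, where \<open>F'\<close> is the Fourier matrix of
  \<open>\<omega>\<^bsup>-1\<^esup>\<close>. The minimal polynomial of the period is \<open>\<Prod> (T - \<eta>\<^sub>t)\<close>: the periods are
  distinct and conjugate because \<open>1 + T + \<dots> + T\<^bsup>p-1\<^esup>\<close> is irreducible, and they are the eigenvalues of
  the integer matrix that describes multiplication by one of them. For the Jacobi sums,
  \<open>p J(\<chi>\<^bsup>ki\<^esup>, \<chi>\<^bsup>kj\<^esup>)\<close> is \<open>G(\<chi>\<^bsup>-k(i + j)\<^esup>)\<close> scaled by a factor for each of \<open>i\<close> and \<open>j\<close>, except
  for a correction at \<open>i = j = 0\<close>, and replacing \<open>\<omega>\<close> by \<open>\<omega>\<^bsup>-1\<^esup>\<close> changes none of the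
  determinants.\<close>

section \<open>Irreducibility of the cyclotomic polynomial of a prime\<close>

definition prime_cyclotomic :: "nat \<Rightarrow> int poly" where
  "prime_cyclotomic p = (\<Sum>i<p. Polynomial.monom 1 i)"

lemma coeff_prime_cyclotomic: "poly.coeff (prime_cyclotomic p) i = (if i < p then 1 else 0)"
  by (simp add: prime_cyclotomic_def coeff_sum)

lemma degree_prime_cyclotomic: "Polynomial.degree (prime_cyclotomic p) = p - 1"
proof (cases "p = 0")
  case True
  then show ?thesis by (simp add: prime_cyclotomic_def)
next
  case False
  have "Polynomial.degree (prime_cyclotomic p) \<le> p - 1"
    by (rule degree_le) (use False in \<open>auto simp: coeff_prime_cyclotomic\<close>)
  moreover have "p - 1 \<le> Polynomial.degree (prime_cyclotomic p)"
    by (rule le_degree) (use False in \<open>auto simp: coeff_prime_cyclotomic\<close>)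
  ultimately show ?thesis by simp
qed

lemma poly_prime_cyclotomic:
  "poly (map_poly of_int (prime_cyclotomic p)) z = (\<Sum>i<p. (z :: 'a :: comm_ring_1) ^ i)"
  by (simp add: prime_cyclotomic_def of_int_poly_hom.hom_sum poly_sum poly_monom)

lemma prime_cyclotomic_root:
  fixes z :: "'a :: field"
  assumes "z ^ p = 1" "z \<noteq> 1"
  shows "poly (map_poly of_int (prime_cyclotomic p)) z = 0"
  using assms by (simp add: poly_prime_cyclotomic geometric_sum)

text \<open>Modulo \<open>p\<close> the polynomial becomes \<open>(T - 1)^(p - 1)\<close>, so both factors of a proper
  factorisation would vanish at \<open>1\<close> modulo \<open>p\<close>, whereas the value at \<open>1\<close> is \<open>p\<close>.\<close>

lemma prime_cyclotomic_no_proper_factor: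
  fixes f g :: "int poly"
  assumes fg: "f * g = prime_cyclotomic CARD('p::prime_card)"
    and df: "Polynomial.degree f > 0" and dg: "Polynomial.degree g > 0"
  shows False
proof -
  define p where "p = CARD('p)"
  have p: "prime p" unfolding p_def by (rule prime_card)
  then have p2: "p \<ge> 2" by (rule prime_ge_2_nat)
  define F G :: "'p mod_ring poly" where "F = map_poly of_int f" and "G = map_poly of_int g"
  define L :: "'p mod_ring poly" where "L = [:-1, 1:]"
  have FG: "F * G = (\<Sum>i<p. Polynomial.monom 1 i)"
    using arg_cong[OF fg, of "map_poly of_int :: int poly \<Rightarrow> 'p mod_ring poly"]
    by (simp add: F_def G_def p_def prime_cyclotomic_def of_int_poly_hom.hom_mult
        of_int_poly_hom.hom_sum)
  have L: "L = Polynomial.monom 1 1 + (-1)"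
    by (simp add: L_def x_as_monom[symmetric, simplified] one_pCons)
  have "L ^ p = Polynomial.monom 1 1 ^ p + (-1) ^ p"
    unfolding L p_def by (subst freshmans_dream[symmetric]) (auto simp: prime_card)
  \<comment> \<open>For \<open>p = 2\<close> the exponent is even, but then \<open>1 = -1\<close> in
    the coefficient field.\<close>
  moreover have "(-1 :: 'p mod_ring poly) ^ p = -1"
  proof (cases "p = 2")
    case True
    then have "(2 :: 'p mod_ring) = 0"
      using of_nat_card_eq_0[where 'a='p] by (simp add: p_def)
    then have "(2 :: 'p mod_ring poly) = 0"
      by (simp add: numeral_poly)
    then show ?thesis
      using True by (simp add: eq_neg_iff_add_eq_0)
  next
    case False
    then have "odd p" using p by (simp add: prime_odd_nat p2 order_less_le)
    then show ?thesis by simp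
  qed
  ultimately have Lp: "L ^ p = Polynomial.monom 1 1 ^ p - 1" by simp
  have "L * (F * G) = Polynomial.monom 1 1 ^ p - 1"
  proof -
    have "F * G = (\<Sum>i<p. (Polynomial.monom 1 1) ^ i)"
      by (simp add: FG x_pow_n del: One_nat_def)
    then show ?thesis
      using power_diff_1_eq[of "Polynomial.monom 1 1 :: 'p mod_ring poly" p] L by simp
  qed
  then have "L * (F * G) = L * L ^ (p - 1)"
    using Lp p2 by (metis power_eq_if not_numeral_le_zero)
  moreover have "L \<noteq> 0" by (simp add: L_def)
  ultimately have FGL: "F * G = L ^ (p - 1)" by simp
  then have ne: "F * G \<noteq> 0" using \<open>L \<noteq> 0\<close> by simp
  have "Polynomial.order 1 (F * G) = p - 1"
    unfolding FGL L_def by (simp add: order_power_n_n)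
  then have ord: "Polynomial.order 1 F + Polynomial.order 1 G = p - 1"
    using order_mult[OF ne] by simp
  \<comment> \<open>The orders at 1 are bounded by the degrees and both pairs add up to
    \<open>p - 1\<close>, so each order equals the corresponding degree and is positive.\<close>
  have "Polynomial.order 1 F \<le> Polynomial.degree f"
    using ne order_degree[of F 1] degree_map_poly_le[of of_int f] by (auto simp: F_def intro: order_trans)
  moreover have "Polynomial.order 1 G \<le> Polynomial.degree g"
    using ne order_degree[of G 1] degree_map_poly_le[of of_int g] by (auto simp: G_def intro: order_trans)
  moreover have "Polynomial.degree f + Polynomial.degree g = p - 1"
    using fg df dg degree_mult_eq[of f g] degree_prime_cyclotomic[of p] by (force simp: p_def)
  ultimately have "Polynomial.order 1 F > 0" "Polynomial.order 1 G > 0"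
    using ord df dg by auto
  then have "poly F 1 = 0" "poly G 1 = 0"
    using ne by (auto simp: order_root)
  then have "of_int (poly f 1) = (0 :: 'p mod_ring)" "of_int (poly g 1) = (0 :: 'p mod_ring)"
    using of_int_hom.poly_map_poly[of f 1] of_int_hom.poly_map_poly[of g 1]
    by (simp_all add: F_def G_def)
  then have "int p dvd poly f 1" "int p dvd poly g 1"
    by (simp_all add: of_int_eq_0_iff_char_dvd p_def)
  then have "int p * int p dvd poly (f * g) 1"
    by (simp add: mult_dvd_mono)
  also have "poly (f * g) 1 = int p"
    unfolding fg using poly_prime_cyclotomic[of "CARD('p)" "1 :: int"] by (simp add: p_def)
  finally show False
    using p2 by (auto dest: zdvd_imp_le)
qed

text \<open>Gauss's lemma applied to a primitive integer polynomial \<open>m\<close> of least degree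
  vanishing at \<open>z\<close>: it divides the cyclotomic polynomial over the integers. It is not
  constant and no proper factor exists, so its degree is \<open>p - 1\<close>.\<close>

lemma prime_root_degree:
  fixes f :: "int poly" and z :: complex
  assumes z: "z ^ CARD('p::prime_card) = 1" "z \<noteq> 1"
    and f: "f \<noteq> 0" "poly (map_poly of_int f) z = 0"
  shows "CARD('p) - 1 \<le> Polynomial.degree f"
proof -
  define S where "S = {f :: int poly. f \<noteq> 0 \<and> poly (map_poly of_int f) z = 0}"
  have "f \<in> S" using f by (simp add: S_def)
  then obtain h where hS: "h \<in> S"
    and hmin: "\<And>q. q \<in> S \<Longrightarrow> Polynomial.degree h \<le> Polynomial.degree q"
    using ex_has_least_nat[of "\<lambda>x. x \<in> S" f Polynomial.degree] by blast
  define m where "m = primitive_part h"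
  have h0: "h \<noteq> 0" using hS by (simp add: S_def)
  have hm: "h = Polynomial.smult (content h) m" by (simp add: m_def)
  have m0: "m \<noteq> 0" using h0 by (simp add: m_def)
  have cm: "content m = 1" using h0 by (simp add: m_def)
  have dm: "Polynomial.degree m = Polynomial.degree h" by (simp add: m_def)
  have "poly (map_poly of_int (Polynomial.smult (content h) m)) z = 0"
    using hS by (subst hm[symmetric]) (simp add: S_def)
  then have "of_int (content h) * poly (map_poly of_int m) z = 0"
    by (simp add: of_int_hom.map_poly_hom_smult)
  then have mz: "poly (map_poly of_int m) z = 0" using h0 by simp
  define \<Phi> where "\<Phi> = prime_cyclotomic CARD('p)"
  have \<Phi>z: "poly (map_poly of_int \<Phi>) z = 0"
    unfolding \<Phi>_def by (rule prime_cyclotomic_root) (use z in auto)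
  \<comment> \<open>Pseudo-division stays inside the integers at the cost of the factor
    \<open>a\<close>. The remainder vanishes at \<open>z\<close>, so minimality of the degree forces
    it to be zero.\<close>
  obtain a q where a: "a \<noteq> 0" and aq: "Polynomial.smult a \<Phi> = m * q + pseudo_mod \<Phi> m"
    using pseudo_mod(1)[OF m0] by blast
  let ?r = "pseudo_mod \<Phi> m"
  have "of_int a * poly (map_poly of_int \<Phi>) z =
      poly (map_poly of_int m) z * poly (map_poly of_int q) z + poly (map_poly of_int ?r) z"
    using arg_cong[OF aq, of "\<lambda>f. poly (map_poly of_int f) z"]
    by (simp add: hom_distribs)
  then have "poly (map_poly of_int ?r) z = 0" by (simp add: \<Phi>z mz)
  then have "?r = 0"
    using pseudo_mod(2)[OF m0, of \<Phi>] hmin[of ?r] dm by (force simp: S_def)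
  then have aq: "Polynomial.smult a \<Phi> = m * q" using aq by simp
  have "content \<Phi> = 1"
  proof -
    have "content \<Phi> dvd poly.coeff \<Phi> 0" by (rule content_dvd_coeff)
    also have "poly.coeff \<Phi> 0 = 1" by (simp add: \<Phi>_def coeff_prime_cyclotomic)
    finally show ?thesis
      by (metis is_unit_content_iff)
  qed
  then have "content q = \<bar>a\<bar>"
    using arg_cong[OF aq, of content] by (simp add: content_mult cm)
  then have q: "q = Polynomial.smult \<bar>a\<bar> (primitive_part q)"
    by (metis content_times_primitive_part)
  \<comment> \<open>Comparing contents determines \<open>a\<close> only up to sign; the sign is
    moved into the cofactor \<open>u\<close>.\<close>
  define u where "u = Polynomial.smult (sgn a) (primitive_part q)"
  have "q = Polynomial.smult a u"
    by (subst q) (simp add: u_def abs_sgn mult.commute)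
  then have "Polynomial.smult a \<Phi> = Polynomial.smult a (m * u)"
    using aq by simp
  then have \<Phi>: "m * u = \<Phi>"
    using a by (metis smult_cancel)
  have "Polynomial.degree m > 0"
  proof (rule ccontr)
    assume "\<not> ?thesis"
    then obtain c where "m = [:c:]" by (auto elim: degree_eq_zeroE)
    then show False using mz m0 by simp
  qed
  then have "Polynomial.degree u = 0"
    using prime_cyclotomic_no_proper_factor[where 'p='p, of m u] \<Phi> by (auto simp: \<Phi>_def)
  moreover have "\<Phi> \<noteq> 0" using \<open>content \<Phi> = 1\<close> by auto
  ultimately have "Polynomial.degree \<Phi> = Polynomial.degree m"
    using \<Phi> degree_mult_eq[of m u] by fastforce
  then show ?thesis
    using hmin[OF \<open>f \<in> S\<close>] dm by (simp add: \<Phi>_def degree_prime_cyclotomic)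
qed

text \<open>The remainder of \<open>f\<close> modulo the cyclotomic polynomial vanishes at
  \<open>z\<close> and has degree below \<open>p - 1\<close>, so it is zero. A nonzero multiple of
  \<open>f\<close> is then a multiple of the cyclotomic polynomial, which also vanishes at
  \<open>w\<close>.\<close>

lemma prime_root_conjugate:
  fixes f :: "int poly" and z w :: complex
  assumes z: "z ^ CARD('p::prime_card) = 1" "z \<noteq> 1"
    and w: "w ^ CARD('p) = 1" "w \<noteq> 1"
    and f: "poly (map_poly of_int f) z = 0"
  shows "poly (map_poly of_int f) w = 0"
proof -
  define \<Phi> where "\<Phi> = prime_cyclotomic CARD('p)"
  have \<Phi>: "poly (map_poly of_int \<Phi>) z = 0" "poly (map_poly of_int \<Phi>) w = 0"
    unfolding \<Phi>_def by (rule prime_cyclotomic_root; use z w in auto)+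
  have "poly.coeff \<Phi> 0 = 1" by (simp add: \<Phi>_def coeff_prime_cyclotomic)
  then have \<Phi>0: "\<Phi> \<noteq> 0" by auto
  obtain a q where a: "a \<noteq> 0" and aq: "Polynomial.smult a f = \<Phi> * q + pseudo_mod f \<Phi>"
    using pseudo_mod(1)[OF \<Phi>0] by blast
  let ?r = "pseudo_mod f \<Phi>"
  have eval: "of_int a * poly (map_poly of_int f) x =
      poly (map_poly of_int \<Phi>) x * poly (map_poly of_int q) x + poly (map_poly of_int ?r) x"
    for x :: complex
    using arg_cong[OF aq, of "\<lambda>f. poly (map_poly of_int f) x"]
    by (simp add: hom_distribs)
  have "poly (map_poly of_int ?r) z = 0"
    using eval[of z] f \<Phi> by simp
  then have "?r = 0"
    using prime_root_degree[OF z, of ?r] pseudo_mod(2)[OF \<Phi>0, of f]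
    by (force simp: \<Phi>_def degree_prime_cyclotomic)
  then show ?thesis using eval[of w] a \<Phi> by simp
qed

text \<open>Minimal polynomials compete with rational polynomials, whereas conjugation is available
  for integer ones; this bridges the two.\<close>

lemma rat_poly_clear_denominators:
  fixes Q :: "rat poly"
  obtains d g where "d \<noteq> 0" "Polynomial.smult (of_int d) Q = map_poly of_int g"
proof -
  have "\<exists>d g. d \<noteq> 0 \<and> Polynomial.smult (of_int d) Q = map_poly of_int g"
  proof (induction Q)
    case 0
    show ?case by (rule exI[of _ 1], rule exI[of _ 0]) simp
  next
    case (pCons a Q)
    then obtain d g where dg: "d \<noteq> 0" "Polynomial.smult (of_int d) Q = map_poly of_int g"
      by blast
    obtain m e where a: "a = of_int m / of_int e" and e: "e > 0"
      by (metis quotient_of_div quotient_of_denom_pos surj_pair)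
    have "Polynomial.smult (of_int (d * e)) (pCons a Q) =
        map_poly of_int (pCons (d * m) (Polynomial.smult e g))"
      using dg e by (simp add: a hom_distribs flip: dg(2) smult_smult)
        (simp add: mult.commute)
    with dg e show ?case
      by (intro exI[of _ "d * e"] exI[of _ "pCons (d * m) (Polynomial.smult e g)"]) auto
  qed
  then show ?thesis using that by blast
qed

section \<open>Gauss periods\<close>

lemma root_pow_of_nat:
  assumes "z ^ CARD('p::prime_card) = 1"
  shows "root_pow z (of_nat m :: 'p mod_ring) = z ^ m"
proof -
  have "to_int_mod_ring (of_nat m :: 'p mod_ring) = int (m mod CARD('p))"
    by (simp add: of_nat_of_int_mod_ring of_int_mod_ring.rep_eq to_int_mod_ring.rep_eq zmod_int)
  then have "root_pow z (of_nat m :: 'p mod_ring) = z ^ (m mod CARD('p))"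
    by (simp add: root_pow_def)
  also have "\<dots> = z ^ (CARD('p) * (m div CARD('p)) + m mod CARD('p))"
    unfolding power_add power_mult assms by simp
  finally show ?thesis by simp
qed

lemma root_pow_add:
  assumes "z ^ CARD('p::prime_card) = 1"
  shows "root_pow z (x + y :: 'p mod_ring) = root_pow z x * root_pow z y"
proof -
  obtain i j where "x = of_nat i" "y = of_nat j"
    using surj_of_nat_mod_ring by metis
  then show ?thesis
    by (metis assms of_nat_add power_add root_pow_of_nat)
qed

lemma root_pow_0 [simp]: "root_pow z 0 = 1"
  by (simp add: root_pow_def)

lemma root_pow_mult_of_nat:
  assumes "z ^ CARD('p::prime_card) = 1"
  shows "root_pow z (x * of_nat m :: 'p mod_ring) = root_pow z x ^ m"
  by (induction m) (simp_all add: distrib_left root_pow_add[OF assms])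

lemma root_pow_power_card:
  assumes "z ^ CARD('p::prime_card) = 1"
  shows "root_pow z (x :: 'p mod_ring) ^ CARD('p) = 1"
  using root_pow_mult_of_nat[OF assms, of x "CARD('p)"] by simp

text \<open>Raising \<open>root_pow z x\<close> to a natural number that represents
  \<open>1 / x\<close> gives back \<open>z\<close>.\<close>

lemma root_pow_neq_1:
  assumes "z ^ CARD('p::prime_card) = 1" "z \<noteq> 1" "(x :: 'p mod_ring) \<noteq> 0"
  shows "root_pow z x \<noteq> 1"
proof
  assume *: "root_pow z x = 1"
  obtain m where m: "inverse x = of_nat m"
    using surj_of_nat_mod_ring by metis
  have "root_pow z (x * of_nat m) = 1"
    using * by (simp add: root_pow_mult_of_nat[OF assms(1)])
  also have "x * of_nat m = of_nat 1"
    using assms(3) by (simp flip: m)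
  finally show False
    using assms by (simp only: root_pow_of_nat[OF assms(1)]) simp
qed

text \<open>Translation by 1 permutes the field and multiplies the sum by
  \<open>root_pow z a\<close>, which differs from 1.\<close>

lemma sum_root_pow:
  assumes "z ^ CARD('p::prime_card) = 1" "z \<noteq> 1" "(a :: 'p mod_ring) \<noteq> 0"
  shows "(\<Sum>x\<in>UNIV. root_pow z (a * x)) = 0"
proof -
  have "(\<Sum>x\<in>UNIV. root_pow z (a * x)) = (\<Sum>x\<in>UNIV. root_pow z (a * (x + 1)))"
    by (rule sum.reindex_bij_betw[symmetric, OF bij_plus_right])
  also have "\<dots> = (\<Sum>x\<in>UNIV. root_pow z (a * x)) * root_pow z a"
    by (simp add: distrib_left root_pow_add[OF assms(1)] sum_distrib_right)
  finally show ?thesis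
    using root_pow_neq_1[OF assms] by simp
qed

text \<open>Cyclicity of the multiplicative group of a finite field is a theorem about ring records;
  this record makes it applicable to the type.\<close>

lemma mod_ring_field_record:
  "field \<lparr>carrier = (UNIV :: 'p::prime_card mod_ring set), monoid.mult = (*), one = 1,
     zero = 0, add = (+)\<rparr>"
proof (rule cring.cring_fieldI2)
  show "cring \<lparr>carrier = (UNIV :: 'p mod_ring set), monoid.mult = (*), one = 1,
     zero = 0, add = (+)\<rparr>"
    by (rule cringI; (rule abelian_groupI comm_monoidI)?)
      (auto simp: algebra_simps intro: exI[of _ "- x" for x] add.left_inverse)
next
  fix a :: "'p mod_ring"
  assume "a \<noteq> \<zero>\<^bsub>\<lparr>carrier = UNIV, monoid.mult = (*), one = 1, zero = 0, add = (+)\<rparr>\<^esub>"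
  then show "\<exists>b\<in>carrier \<lparr>carrier = UNIV, monoid.mult = (*), one = 1, zero = 0, add = (+)\<rparr>.
      a \<otimes>\<^bsub>\<lparr>carrier = UNIV, monoid.mult = (*), one = 1, zero = 0, add = (+)\<rparr>\<^esub> b =
      \<one>\<^bsub>\<lparr>carrier = UNIV, monoid.mult = (*), one = 1, zero = 0, add = (+)\<rparr>\<^esub>"
    by (auto intro!: exI[of _ "inverse a"])
qed auto

lemma ex_mod_ring_generator:
  obtains g :: "'p::prime_card mod_ring" where "g \<noteq> 0" "\<And>x. x \<noteq> 0 \<Longrightarrow> \<exists>j::nat. x = g ^ j"
proof -
  define R :: "'p mod_ring ring" where "R = \<lparr>carrier = (UNIV :: 'p mod_ring set), monoid.mult = (*), one = 1,
     zero = 0, add = (+)\<rparr>"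
  have pow: "x [^]\<^bsub>R\<^esub> j = x ^ j" for x :: "'p mod_ring" and j :: nat
    by (induction j) (simp_all add: R_def nat_pow_def mult.commute)
  have "field R" unfolding R_def by (rule mod_ring_field_record)
  moreover have "finite (carrier R)" by (simp add: R_def)
  ultimately obtain g where "g \<in> carrier (mult_of R)"
    "carrier (mult_of R) = {g [^]\<^bsub>R\<^esub> i |i::nat. i \<in> UNIV}"
    using field.finite_field_mult_group_has_gen by blast
  then have "g \<noteq> 0" "UNIV - {0} = {g ^ i | i. True}"
    by (simp_all add: pow) (simp_all add: R_def)
  then show ?thesis using that[of g] by blast
qed

text \<open>The cosets of \<open>U\<^sub>k\<close> in the multiplicative group are represented by \<open>g ^ t\<close>, \<open>t < n\<close>.\<close>

locale gauss_periods =
  fixes g :: "'p::prime_card mod_ring" and \<zeta> :: complex and k n :: nat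
  assumes g_nonzero: "g \<noteq> 0"
    and generator: "\<And>x. x \<noteq> 0 \<Longrightarrow> \<exists>j::nat. x = g ^ j"
    and card_eq: "CARD('p) - 1 = k * n"
    and k_pos: "k \<ge> 1" and n_ge_2: "n \<ge> 2"
    and \<zeta>_power: "\<zeta> ^ CARD('p) = 1" and \<zeta>_neq_1: "\<zeta> \<noteq> 1"
begin

definition U :: "'p mod_ring set" where "U = roots_U k"

definition period :: "'p mod_ring \<Rightarrow> complex" where
  "period a = (\<Sum>u\<in>U. root_pow \<zeta> (a * u))"

lemma card_nonzero: "card (UNIV - {0 :: 'p mod_ring}) = k * n"
  using card_eq by (simp add: card_Diff_singleton)

lemma kn_pos: "k * n > 0"
  using k_pos n_ge_2 by simp

text \<open>Multiplication by \<open>g\<close> permutes the nonzero elements, so their nonzero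
  product is unchanged by the factor \<open>g ^ (k * n)\<close>.\<close>

lemma generator_power_one: "g ^ (k * n) = 1"
proof -
  have "(\<Prod>x\<in>UNIV - {0}. g * x) = (\<Prod>x\<in>UNIV - {0 :: 'p mod_ring}. x)"
    by (rule prod.reindex_bij_witness[of _ "\<lambda>x. x / g" "\<lambda>x. g * x"])
      (auto simp: g_nonzero)
  then have "g ^ card (UNIV - {0 :: 'p mod_ring}) * (\<Prod>x\<in>UNIV - {0}. x) = (\<Prod>x\<in>UNIV - {0 :: 'p mod_ring}. x)"
    by (simp add: prod.distrib del: finite_Diff_insert)
  moreover have "(\<Prod>x\<in>UNIV - {0 :: 'p mod_ring}. x) \<noteq> 0" by simp
  ultimately show ?thesis by (simp only: card_nonzero) simp
qed

lemma generator_power_mod: "g ^ (j mod (k * n)) = g ^ j"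
proof -
  have "g ^ j = g ^ (k * n * (j div (k * n)) + j mod (k * n))" by simp
  also have "\<dots> = g ^ (j mod (k * n))"
    unfolding power_add power_mult[of g "k * n"] generator_power_one by simp
  finally show ?thesis by simp
qed

lemma generator_inj: "inj_on (\<lambda>j. g ^ j) {..<k * n}"
proof (rule eq_card_imp_inj_on)
  have "(\<lambda>j. g ^ j) ` {..<k * n} = UNIV - {0}"
  proof (intro equalityI subsetI)
    fix x :: "'p mod_ring" assume "x \<in> UNIV - {0}"
    then obtain j where "x = g ^ j" using generator by blast
    then show "x \<in> (\<lambda>j. g ^ j) ` {..<k * n}"
      using kn_pos by (intro image_eqI[of _ _ "j mod (k * n)"]) (simp_all add: generator_power_mod)
  qed (use g_nonzero in auto)
  then show "card ((\<lambda>j. g ^ j) ` {..<k * n}) = card {..<k * n}"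
    using card_nonzero by simp
qed simp

lemma generator_power_eq_iff: "g ^ i = g ^ j \<longleftrightarrow> i mod (k * n) = j mod (k * n)"
proof
  assume "g ^ i = g ^ j"
  then have "g ^ (i mod (k * n)) = g ^ (j mod (k * n))" by (simp only: generator_power_mod)
  then show "i mod (k * n) = j mod (k * n)"
    using generator_inj kn_pos by (auto dest: inj_onD)
next
  assume "i mod (k * n) = j mod (k * n)"
  then show "g ^ i = g ^ j" by (metis generator_power_mod)
qed

lemma U_iff: "u \<in> U \<longleftrightarrow> u ^ k = 1"
  using k_pos by (auto simp: U_def roots_U_def power_0_left)

lemma U_nonzero: "u \<in> U \<Longrightarrow> u \<noteq> 0"
  by (simp add: U_def roots_U_def)

lemma one_in_U: "1 \<in> U"
  by (simp add: U_iff)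

text \<open>Taking \<open>k\<close>-th powers removes the elements of \<open>U\<close> and leaves
  \<open>g ^ (s * k) = g ^ (t * k)\<close>, with both exponents below the order \<open>k * n\<close>
  of \<open>g\<close>.\<close>

lemma coset_unique:
  assumes "g ^ s * u = g ^ t * v" "u \<in> U" "v \<in> U" "s < n" "t < n"
  shows "s = t"
proof -
  have "(g ^ s * u) ^ k = (g ^ t * v) ^ k" using assms(1) by simp
  then have "g ^ (s * k) = g ^ (t * k)"
    using assms(2,3) by (simp add: power_mult_distrib U_iff power_mult)
  then have "s * k mod (k * n) = t * k mod (k * n)" by (simp only: generator_power_eq_iff)
  moreover have "s * k < k * n" "t * k < k * n" using assms k_pos by simp_all
  ultimately show ?thesis using k_pos by simp
qed

lemma coset_bij: "bij_betw (\<lambda>(t, u). g ^ t * u) ({..<n} \<times> U) (UNIV - {0})"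
  unfolding bij_betw_def
proof
  show "inj_on (\<lambda>(t, u). g ^ t * u) ({..<n} \<times> U)"
  proof (rule inj_onI)
    fix a b assume ab: "a \<in> {..<n} \<times> U" "b \<in> {..<n} \<times> U"
      and "(\<lambda>(t, u). g ^ t * u) a = (\<lambda>(t, u). g ^ t * u) b"
    then have eq: "g ^ fst a * snd a = g ^ fst b * snd b" by (simp add: case_prod_unfold)
    then have "fst a = fst b" using coset_unique ab by auto
    then show "a = b" using eq g_nonzero by (simp add: prod_eq_iff)
  qed
  show "(\<lambda>(t, u). g ^ t * u) ` ({..<n} \<times> U) = UNIV - {0}"
  proof (intro equalityI subsetI)
    fix x :: "'p mod_ring" assume "x \<in> UNIV - {0}"
    then obtain j where j: "x = g ^ j" using generator by blast
    \<comment> \<open>Division of the exponent \<open>j\<close> by \<open>n\<close> with remainder: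
      the remainder names the coset, the multiple of \<open>n\<close> gives an element of
      \<open>U\<close>.\<close>
    have "(g ^ (n * (j div n))) ^ k = (g ^ (k * n)) ^ (j div n)"
      by (simp flip: power_mult add: ac_simps)
    then have "g ^ (n * (j div n)) \<in> U"
      by (simp add: U_iff generator_power_one)
    moreover have "x = g ^ (j mod n) * g ^ (n * (j div n))"
      by (simp add: j flip: power_add)
    ultimately show "x \<in> (\<lambda>(t, u). g ^ t * u) ` ({..<n} \<times> U)"
      using n_ge_2 by (intro image_eqI[of _ _ "(j mod n, g ^ (n * (j div n)))"]) auto
  qed (use g_nonzero U_nonzero in auto)
qed

lemma sum_nonzero_cosets:
  "(\<Sum>x\<in>UNIV - {0}. f x) = (\<Sum>t<n. \<Sum>u\<in>U. f (g ^ t * u))"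
proof -
  have "(\<Sum>x\<in>UNIV - {0}. f x) = (\<Sum>a\<in>{..<n} \<times> U. f ((\<lambda>(t, u). g ^ t * u) a))"
    by (rule sum.reindex_bij_betw[symmetric, OF coset_bij])
  also have "\<dots> = (\<Sum>t<n. \<Sum>u\<in>U. f (g ^ t * u))"
    by (subst sum.cartesian_product) (simp add: case_prod_unfold)
  finally show ?thesis .
qed

lemma U_mult_bij: "v \<in> U \<Longrightarrow> bij_betw (\<lambda>u. u * v) U U"
  by (rule bij_betwI[of _ _ _ "\<lambda>u. u / v"])
    (auto simp: U_iff power_mult_distrib power_divide dest: U_nonzero[unfolded U_iff])

lemma period_mult_U: "v \<in> U \<Longrightarrow> period (a * v) = period a"
  unfolding period_def
  by (subst sum.reindex_bij_betw[symmetric, OF U_mult_bij[of v]]) (simp_all add: ac_simps)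

lemma period_0: "period 0 = of_nat (card U)"
  by (simp add: period_def)

text \<open>The cosets partition the nonzero elements, and the sum over the whole field vanishes;
  what is left is minus the term 1 at \<open>x = 0\<close>.\<close>

lemma sum_periods:
  assumes "a \<noteq> 0"
  shows "(\<Sum>t<n. period (a * g ^ t)) = -1"
proof -
  have "(\<Sum>t<n. period (a * g ^ t)) = (\<Sum>x\<in>UNIV - {0}. root_pow \<zeta> (a * x))"
    unfolding period_def by (simp add: sum_nonzero_cosets mult.assoc)
  also have "\<dots> = (\<Sum>x\<in>UNIV. root_pow \<zeta> (a * x)) - 1"
    by (simp add: sum_diff1)
  finally show ?thesis
    by (simp add: sum_root_pow[OF \<zeta>_power \<zeta>_neq_1 assms])
qed

end

section \<open>Linear independence of the powers of a root of unity of prime order\<close>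

lemma bij_betw_of_nat_mod_ring:
  "bij_betw of_nat {..<CARD('p::prime_card)} (UNIV :: 'p mod_ring set)"
proof -
  have im: "of_nat ` {..<CARD('p)} = (UNIV :: 'p mod_ring set)"
    using surj_of_nat_mod_ring by blast
  then have "inj_on (of_nat :: nat \<Rightarrow> 'p mod_ring) {..<CARD('p)}"
    by (intro eq_card_imp_inj_on) simp_all
  with im show ?thesis by (simp add: bij_betw_def)
qed

text \<open>The condition \<open>d 0 = 0\<close> leaves only the powers of \<open>z\<close> with
  exponents 1 to \<open>p - 1\<close>. Dividing a relation among them by \<open>z\<close> gives an
  integer polynomial of degree at most \<open>p - 2\<close> that vanishes at \<open>z\<close>, hence
  the zero polynomial.\<close>

lemma root_pow_independent:
  fixes d :: "'p::prime_card mod_ring \<Rightarrow> int" and z :: complex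
  assumes z: "z ^ CARD('p) = 1" "z \<noteq> 1"
    and d: "d 0 = 0" "(\<Sum>x\<in>UNIV. of_int (d x) * root_pow z x) = 0"
  shows "d x = 0"
proof -
  define m where "m = CARD('p) - 1"
  have m: "CARD('p) = Suc m"
    by (simp add: m_def)
  have m_pos: "m > 0"
    using prime_gt_1_nat[OF prime_card[where 'a='p]] by (simp add: m_def)
  define f where "f = (\<Sum>i<m. Polynomial.monom (d (of_nat (Suc i))) i)"
  have coeff_f: "poly.coeff f i = (if i < m then d (of_nat (Suc i)) else 0)" for i
    by (simp add: f_def coeff_sum)
  have "z * poly (map_poly of_int f) z = (\<Sum>i<m. of_int (d (of_nat (Suc i))) * z ^ Suc i)"
    by (simp add: f_def of_int_poly_hom.hom_sum poly_sum poly_monom sum_distrib_left ac_simps)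
  also have "\<dots> = (\<Sum>i<CARD('p). of_int (d (of_nat i)) * z ^ i)"
    unfolding m by (subst sum.lessThan_Suc_shift) (simp add: d(1))
  also have "\<dots> = (\<Sum>i<CARD('p). of_int (d (of_nat i)) * root_pow z (of_nat i :: 'p mod_ring))"
    by (simp add: root_pow_of_nat[OF z(1)])
  also have "\<dots> = (\<Sum>x\<in>UNIV. of_int (d x) * root_pow z x)"
    by (rule sum.reindex_bij_betw[OF bij_betw_of_nat_mod_ring])
  finally have "z * poly (map_poly of_int f) z = 0"
    using d(2) by simp
  moreover have "z \<noteq> 0" using z(1) by (auto simp: power_0_left)
  ultimately have fz: "poly (map_poly of_int f) z = 0" by simp
  have "Polynomial.degree f \<le> m - 1"
    by (rule degree_le) (auto simp: coeff_f)
  then have f0: "f = 0"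
    using prime_root_degree[OF z _ fz] m m_pos by force
  obtain i where i: "i < CARD('p)" "x = of_nat i"
    using surj_of_nat_mod_ring by metis
  show ?thesis
  proof (cases i)
    case 0
    then show ?thesis using i d by simp
  next
    case (Suc j)
    then show ?thesis using i coeff_f[of j] f0 m by simp
  qed
qed

text \<open>The difference of two monic polynomials of degree \<open>card A\<close> has smaller
  degree, yet vanishes at \<open>card A\<close> distinct points.\<close>

lemma monic_eq_prod_roots:
  fixes P :: "'a :: idom poly"
  assumes P: "Polynomial.degree P = card A" "lead_coeff P = 1"
    and A: "finite A" "inj_on f A" "\<And>t. t \<in> A \<Longrightarrow> poly P (f t) = 0"
  shows "P = (\<Prod>t\<in>A. [:- f t, 1:])"
proof (cases "A = {}")
  case True
  then show ?thesis using P by (auto elim!: degree_eq_zeroE)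
next
  case False
  define R where "R = (\<Prod>t\<in>A. [:- f t, 1:])"
  have R: "Polynomial.degree R = card A"
    by (simp add: R_def degree_prod_eq_sum_degree)
  have R1: "lead_coeff R = 1"
    by (simp add: R_def lead_coeff_prod)
  have c: "card A > 0" using A False by (simp add: card_gt_0_iff)
  show ?thesis
  proof (rule ccontr)
    assume "P \<noteq> (\<Prod>t\<in>A. [:- f t, 1:])"
    then have ne: "P - R \<noteq> 0" by (simp add: R_def)
    have "poly.coeff (P - R) (card A) = 0" using P R R1 by simp
    moreover have "Polynomial.degree (P - R) \<le> card A"
      using P R by (simp add: degree_diff_le)
    ultimately have "Polynomial.degree (P - R) < card A"
      using ne by (metis le_neq_implies_less leading_coeff_0_iff)
    moreover have "card (f ` A) \<le> card {x. poly (P - R) x = 0}"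
      using A by (intro card_mono poly_roots_finite[OF ne])
        (auto simp: R_def poly_prod intro: prod_zero)
    ultimately show False
      using card_poly_roots_bound[OF ne] A by (simp add: card_image)
  qed
qed

lemma coeff_0_prod_linear: "poly.coeff (\<Prod>t\<in>A. [:- f t, 1:]) 0 = (\<Prod>t\<in>A. - f t :: 'a :: idom)"
  by (simp add: poly_0_coeff_0[symmetric] poly_prod)

text \<open>The linear coefficient is the derivative at 0, here written through the logarithmic
  derivative. The sum of reciprocals is the same one that appears in the minor of the Hankel
  matrix.\<close>

lemma coeff_1_prod_linear:
  fixes f :: "'b \<Rightarrow> 'a :: field"
  assumes "finite A" "\<And>t. t \<in> A \<Longrightarrow> f t \<noteq> 0"
  shows "poly.coeff (\<Prod>t\<in>A. [:- f t, 1:]) 1 = - (\<Prod>t\<in>A. - f t) * (\<Sum>t\<in>A. 1 / f t)"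
  using assms
proof (induction A rule: finite_induct)
  case (insert t A)
  let ?R = "\<Prod>t\<in>A. [:- f t, 1:]"
  have "poly.coeff ([:- f t, 1:] * ?R) 1 = - f t * poly.coeff ?R 1 + poly.coeff ?R 0"
    by (simp add: mult_pCons_left)
  then show ?case
    using insert by (simp add: coeff_0_prod_linear field_simps)
qed simp

section \<open>Distinctness, conjugacy and minimal polynomial of the periods\<close>

context gauss_periods
begin

lemma period_eq_sum_indicator:
  assumes "a \<noteq> 0"
  shows "period a = (\<Sum>x\<in>UNIV. of_int (of_bool (x \<in> (*) a ` U)) * root_pow \<zeta> x)"
proof -
  have "period a = (\<Sum>x\<in>(*) a ` U. root_pow \<zeta> x)"
    unfolding period_def using assms by (subst sum.reindex) (auto intro: inj_onI)
  also have "\<dots> = (\<Sum>x\<in>UNIV. of_int (of_bool (x \<in> (*) a ` U)) * root_pow \<zeta> x)"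
    by (rule sum.mono_neutral_cong_left) auto
  finally show ?thesis .
qed

text \<open>A vanishing period would be a relation between powers of \<open>\<zeta>\<close> in which
  \<open>a\<close> has coefficient 1.\<close>

lemma period_nonzero:
  assumes "a \<noteq> 0"
  shows "period a \<noteq> 0"
proof
  assume "period a = 0"
  then have "(\<Sum>x\<in>UNIV. of_int (of_bool (x \<in> (*) a ` U)) * root_pow \<zeta> x) = 0"
    by (simp only: period_eq_sum_indicator[OF assms])
  moreover have "of_bool (0 \<in> (*) a ` U) = (0 :: int)"
    using U_nonzero assms by auto
  ultimately have "of_bool (a \<in> (*) a ` U) = (0 :: int)"
    by (rule root_pow_independent[OF \<zeta>_power \<zeta>_neq_1, rotated])
  moreover have "a \<in> (*) a ` U"
    using one_in_U by (rule image_eqI[rotated]) simp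
  ultimately show False by simp
qed

text \<open>Equal periods give a relation whose coefficients are the difference of two coset
  indicators; independence makes the cosets meet, so they coincide.\<close>

lemma period_inj: "inj_on (\<lambda>t. period (g ^ t)) {..<n}"
proof (rule inj_onI)
  fix s t assume st: "s \<in> {..<n}" "t \<in> {..<n}" and eq: "period (g ^ s) = period (g ^ t)"
  define d :: "'p mod_ring \<Rightarrow> int" where
    "d x = of_bool (x \<in> (*) (g ^ s) ` U) - of_bool (x \<in> (*) (g ^ t) ` U)" for x
  have "(\<Sum>x\<in>UNIV. of_int (d x) * root_pow \<zeta> x) = 0"
    using eq g_nonzero
    by (simp add: d_def left_diff_distrib sum_subtractf period_eq_sum_indicator)
  moreover have "d 0 = 0"
    using U_nonzero g_nonzero by (auto simp: d_def)
  ultimately have "d (g ^ s) = 0"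
    by (rule root_pow_independent[OF \<zeta>_power \<zeta>_neq_1, rotated])
  moreover have "g ^ s \<in> (*) (g ^ s) ` U"
    using one_in_U by (auto simp: image_iff)
  ultimately have "g ^ s \<in> (*) (g ^ t) ` U"
    by (auto simp: d_def split: if_splits)
  then obtain u where "u \<in> U" "g ^ s * 1 = g ^ t * u" by auto
  then show "s = t" using coset_unique[OF _ one_in_U] st by blast
qed

text \<open>One integer polynomial \<open>h\<close>, built from natural representatives of
  \<open>U\<close>, takes the value \<open>period b\<close> at \<open>root_pow \<zeta> b\<close> for
  every \<open>b\<close>. Conjugating the root of the composition of \<open>Q\<close> with
  \<open>h\<close> therefore conjugates the period.\<close>

lemma period_conjugate:
  fixes Q :: "int poly"
  assumes Q: "poly (map_poly of_int Q) (period 1) = 0" and a: "a \<noteq> 0"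
  shows "poly (map_poly of_int Q) (period a) = 0"
proof -
  define rep where "rep x = nat (to_int_mod_ring x)" for x :: "'p mod_ring"
  have rep: "of_nat (rep x) = x" for x
  proof -
    have "to_int_mod_ring x \<ge> 0"
      using range_to_int_mod_ring[where 'a='p] by (metis atLeastLessThan_iff rangeI)
    then show ?thesis
      by (simp add: rep_def of_nat_of_int_mod_ring)
  qed
  define h :: "int poly" where "h = (\<Sum>u\<in>U. Polynomial.monom 1 (rep u))"
  have h: "poly (map_poly of_int h) (root_pow \<zeta> b) = period b" for b
  proof -
    have "poly (map_poly of_int h) (root_pow \<zeta> b) = (\<Sum>u\<in>U. root_pow \<zeta> b ^ rep u)"
      by (simp add: h_def of_int_poly_hom.hom_sum poly_sum poly_monom)
    also have "\<dots> = period b"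
      unfolding period_def
      by (simp add: rep flip: root_pow_mult_of_nat[OF \<zeta>_power])
    finally show ?thesis .
  qed
  have Qh: "poly (map_poly of_int (Q \<circ>\<^sub>p h)) (root_pow \<zeta> b) = poly (map_poly of_int Q) (period b)" for b
    by (simp add: of_int_hom.map_poly_pcompose poly_pcompose h)
  have "poly (map_poly of_int (Q \<circ>\<^sub>p h)) (root_pow \<zeta> a) = 0"
  proof (rule prime_root_conjugate)
    show "poly (map_poly of_int (Q \<circ>\<^sub>p h)) (root_pow \<zeta> (1 :: 'p mod_ring)) = 0"
      by (simp only: Qh Q)
  qed (use root_pow_power_card[OF \<zeta>_power] root_pow_neq_1[OF \<zeta>_power \<zeta>_neq_1] a in auto)
  then show ?thesis by (simp only: Qh)
qed

text \<open>Integer coordinates of \<open>period (a * y)\<close> in the periods of the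
  \<open>a * g ^ t\<close>, independent of \<open>a\<close>. At \<open>y = 0\<close> the value
  \<open>card U\<close> is spread evenly, using that these periods add up to -1.\<close>

definition period_coord :: "'p mod_ring \<Rightarrow> nat \<Rightarrow> int" where
  "period_coord y t = (if y = 0 then - int (card U) else of_bool (y \<in> (*) (g ^ t) ` U))"

lemma period_coord:
  assumes "a \<noteq> 0"
  shows "period (a * y) = (\<Sum>t<n. of_int (period_coord y t) * period (a * g ^ t))"
proof (cases "y = 0")
  case True
  then show ?thesis
    using sum_periods[OF assms] by (simp add: period_coord_def period_0 sum_negf flip: sum_distrib_left)
next
  case False
  then have "y \<in> (\<lambda>(t, u). g ^ t * u) ` ({..<n} \<times> U)"
    using bij_betw_imp_surj_on[OF coset_bij] by simp
  then obtain s u where su: "s < n" "u \<in> U" "y = g ^ s * u"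
    by auto
  have "y \<in> (*) (g ^ t) ` U \<longleftrightarrow> t = s" if "t < n" for t
    using su that coset_unique by blast
  then have "(\<Sum>t<n. of_int (period_coord y t) * period (a * g ^ t)) =
      (\<Sum>t<n. if t = s then period (a * g ^ t) else 0)"
    using False by (intro sum.cong) (auto simp: period_coord_def)
  also have "\<dots> = period (a * g ^ s)" using su by simp
  also have "\<dots> = period (a * y)"
    using su period_mult_U[of u "a * g ^ s"] by (simp add: mult.assoc)
  finally show ?thesis by simp
qed

text \<open>For each term \<open>u\<close> of the first factor the second is rewritten as
  \<open>period (a * u)\<close>, so that \<open>u\<close> can be factored out of the sum of the two
  exponents.\<close>

lemma period_mult:
  "period (a * y) * period a = (\<Sum>v\<in>U. period (a * (y + v)))"
proof -
  have "period (a * y) * period a = (\<Sum>u\<in>U. root_pow \<zeta> (a * y * u) * period (a * u))"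
    by (simp add: period_mult_U period_def[of "a * y"] sum_distrib_right)
  also have "\<dots> = (\<Sum>u\<in>U. \<Sum>v\<in>U. root_pow \<zeta> (a * (y + v) * u))"
    unfolding period_def sum_distrib_left
    by (simp add: algebra_simps root_pow_add[OF \<zeta>_power])
  also have "\<dots> = (\<Sum>v\<in>U. period (a * (y + v)))"
    unfolding period_def by (rule sum.swap)
  finally show ?thesis .
qed

text \<open>Row \<open>s\<close> holds the coordinates of
  \<open>period (a * g ^ s) * period a\<close>, for any nonzero \<open>a\<close>.\<close>

definition mult_mat :: "int mat" where
  "mult_mat = mat n n (\<lambda>(s, t). \<Sum>v\<in>U. period_coord (g ^ s + v) t)"

lemma mult_mat_carrier: "mult_mat \<in> carrier_mat n n"
  by (simp add: mult_mat_def)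

text \<open>The periods of the \<open>a g\<^sup>t\<close> form an eigenvector for the eigenvalue \<open>period a\<close>, and the integer matrix
  does not depend on \<open>a\<close>. So one monic integer polynomial of degree \<open>n\<close> has all periods as roots.\<close>

lemma poly_char_poly_period:
  assumes "a \<noteq> 0"
  shows "poly (map_poly of_int (char_poly mult_mat)) (period a) = 0"
proof -
  define N :: "complex mat" where "N = map_mat of_int mult_mat"
  define v where "v = vec n (\<lambda>t. period (a * g ^ t))"
  have N: "N \<in> carrier_mat n n" by (simp add: N_def mult_mat_def)
  have "v \<noteq> 0\<^sub>v n"
  proof
    assume "v = 0\<^sub>v n"
    then have "v $ 0 = 0" using n_ge_2 by simp
    then show False
      using n_ge_2 period_nonzero[OF assms] by (simp add: v_def)
  qed
  moreover have "N *\<^sub>v v = period a \<cdot>\<^sub>v v"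
  proof (rule eq_vecI)
    fix s assume "s < dim_vec (period a \<cdot>\<^sub>v v)"
    then have s: "s < n" by (simp add: v_def)
    have "(N *\<^sub>v v) $ s =
        (\<Sum>t<n. (\<Sum>u\<in>U. of_int (period_coord (g ^ s + u) t)) * period (a * g ^ t))"
      using s by (simp add: N_def mult_mat_def v_def scalar_prod_def atLeast0LessThan)
    also have "\<dots> = (\<Sum>u\<in>U. \<Sum>t<n. of_int (period_coord (g ^ s + u) t) * period (a * g ^ t))"
      by (simp add: sum_distrib_right sum.swap[of _ U])
    also have "\<dots> = period (a * g ^ s) * period a"
      by (simp add: period_mult period_coord[OF assms, symmetric])
    finally show "(N *\<^sub>v v) $ s = (period a \<cdot>\<^sub>v v) $ s"
      using s by (simp add: v_def)
  qed (simp add: N_def mult_mat_def v_def)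
  ultimately have "eigenvector N v (period a)"
    using N by (simp add: eigenvector_def v_def)
  then have "eigenvalue N (period a)" by (auto simp: eigenvalue_def)
  then have "poly (char_poly N) (period a) = 0"
    using eigenvalue_root_char_poly[OF N] by simp
  then show ?thesis
    by (simp add: N_def of_int_hom.char_poly_hom[OF mult_mat_carrier])
qed

lemma char_poly_eq_prod:
  "map_poly of_int (char_poly mult_mat) = (\<Prod>t<n. [:- period (g ^ t), 1:])"
  using degree_monic_char_poly[OF mult_mat_carrier] period_inj g_nonzero
  by (intro monic_eq_prod_roots) (auto intro: poly_char_poly_period)

text \<open>A nonzero rational polynomial that vanishes at one period vanishes, after clearing
  denominators and conjugating, at all \<open>n\<close> distinct periods, so its degree is at least
  \<open>n\<close>.\<close>

lemma is_min_poly_char_poly: "is_min_poly (map_poly of_int (char_poly mult_mat)) (period 1)"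
  unfolding is_min_poly_def
proof (intro conjI allI impI)
  note dm = degree_monic_char_poly[OF mult_mat_carrier]
  show "lead_coeff (map_poly rat_of_int (char_poly mult_mat)) = 1"
    using dm by simp
  have "map_poly of_rat (map_poly rat_of_int (char_poly mult_mat)) =
      (map_poly of_int (char_poly mult_mat) :: complex poly)"
    by (simp add: map_poly_map_poly o_def)
  then show "poly (map_poly of_rat (map_poly rat_of_int (char_poly mult_mat))) (period 1) = 0"
    using poly_char_poly_period[of 1] by simp
  fix Q :: "rat poly"
  assume Q: "Q \<noteq> 0" "poly (map_poly of_rat Q) (period 1) = 0"
  obtain d h where dh: "d \<noteq> 0" "Polynomial.smult (of_int d) Q = map_poly of_int h"
    by (rule rat_poly_clear_denominators)
  have "(map_poly of_int h :: complex poly) = map_poly of_rat (map_poly rat_of_int h)"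
    by (simp add: map_poly_map_poly o_def)
  also have "\<dots> = Polynomial.smult (of_int d) (map_poly of_rat Q)"
    by (simp flip: dh(2) add: of_rat_hom.map_poly_hom_smult)
  finally have h: "(map_poly of_int h :: complex poly) = Polynomial.smult (of_int d) (map_poly of_rat Q)" .
  then have "poly (map_poly of_int h) (period 1) = 0" using Q by simp
  then have roots: "poly (map_poly of_rat Q) (period a) = 0" if "a \<noteq> 0" for a
    using period_conjugate[OF _ that, of h] dh h by simp
  have ne: "(map_poly of_rat Q :: complex poly) \<noteq> 0" using Q by simp
  have "n = card ((\<lambda>t. period (g ^ t)) ` {..<n})"
    using period_inj by (simp add: card_image)
  also have "\<dots> \<le> card {x. poly (map_poly of_rat Q) x = (0 :: complex)}"
    by (intro card_mono poly_roots_finite[OF ne]) (auto simp: g_nonzero roots)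
  also have "\<dots> \<le> Polynomial.degree (map_poly of_rat Q :: complex poly)"
    by (rule card_poly_roots_bound[OF ne])
  finally show "Polynomial.degree (map_poly rat_of_int (char_poly mult_mat)) \<le> Polynomial.degree Q"
    using dm by simp
qed

lemma period_poly_eq: "period_poly TYPE('p) \<zeta> k = char_poly mult_mat"
proof -
  have "gauss_period TYPE('p) \<zeta> k = period 1"
    by (simp add: gauss_period_def period_def U_def)
  moreover have "(THE P. is_min_poly (map_poly of_int P) (period 1)) = char_poly mult_mat"
  proof (rule the_equality)
    fix P :: "int poly" assume "is_min_poly (map_poly of_int P) (period 1)"
    then have "map_poly of_int P = (map_poly of_int (char_poly mult_mat) :: rat poly)"
      using is_min_poly_char_poly by (rule is_min_poly_unique)
    then show "P = char_poly mult_mat" by simp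
  qed (rule is_min_poly_char_poly)
  ultimately show ?thesis by (simp add: period_poly_def int_min_poly_def)
qed

lemma coeff_period_poly:
  "of_int (poly.coeff (period_poly TYPE('p) \<zeta> k) 0) = (-1) ^ n * (\<Prod>t<n. period (g ^ t))"
  "of_int (poly.coeff (period_poly TYPE('p) \<zeta> k) 1) =
     (-1) ^ (n - 1) * (\<Prod>t<n. period (g ^ t)) * (\<Sum>t<n. 1 / period (g ^ t))"
proof -
  have c: "of_int (poly.coeff (period_poly TYPE('p) \<zeta> k) i) =
      poly.coeff (\<Prod>t<n. [:- period (g ^ t), 1:]) i" for i
    by (simp add: period_poly_eq flip: char_poly_eq_prod)
  have "(\<Prod>t<n. - period (g ^ t)) = (-1) ^ n * (\<Prod>t<n. period (g ^ t))"
    by (simp add: prod_uminus)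
  then show "of_int (poly.coeff (period_poly TYPE('p) \<zeta> k) 0) = (-1) ^ n * (\<Prod>t<n. period (g ^ t))"
    by (simp only: c coeff_0_prod_linear)
  have "poly.coeff (\<Prod>t<n. [:- period (g ^ t), 1:]) 1 =
      - ((-1) ^ n) * (\<Prod>t<n. period (g ^ t)) * (\<Sum>t<n. 1 / period (g ^ t))"
    by (subst coeff_1_prod_linear) (simp_all add: period_nonzero g_nonzero prod_uminus)
  moreover have "- ((-1) ^ n) = ((-1) ^ (n - 1) :: complex)"
    using n_ge_2 by (simp add: power_eq_if)
  ultimately show "of_int (poly.coeff (period_poly TYPE('p) \<zeta> k) 1) =
     (-1) ^ (n - 1) * (\<Prod>t<n. period (g ^ t)) * (\<Sum>t<n. 1 / period (g ^ t))"
    by (simp only: c)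
qed

end

section \<open>Hankel matrices of a discrete Fourier transform\<close>

lemma det_mat_diag: "det (mat_diag n f) = (\<Prod>i<n. f i :: 'a :: comm_ring_1)"
proof -
  have "diag_mat (mat_diag n f) = map f [0..<n]"
    by (auto simp: diag_mat_def mat_diag_def)
  moreover have "upper_triangular (mat_diag n f)"
    by (auto simp: mat_diag_def)
  ultimately have "det (mat_diag n f) = prod_list (map f [0..<n])"
    using det_upper_triangular[of "mat_diag n f" n] by simp
  also have "\<dots> = (\<Prod>i<n. f i)"
    using prod.distinct_set_conv_list[of "[0..<n]" f] by (simp add: atLeast0LessThan)
  finally show ?thesis .
qed

lemma det_mat_scale:
  fixes a b :: "nat \<Rightarrow> 'a :: comm_ring_1"
  shows "det (mat n n (\<lambda>(i, j). a i * f i j * b j)) =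
    (\<Prod>i<n. a i) * det (mat n n (\<lambda>(i, j). f i j)) * (\<Prod>j<n. b j)"
proof -
  have "mat n n (\<lambda>(i, j). a i * f i j * b j) =
      mat_diag n a * mat n n (\<lambda>(i, j). f i j) * mat_diag n b"
    by (subst mat_diag_mult_left[of _ n n], simp, subst mat_diag_mult_right[of _ n n], simp,
        rule eq_matI, auto)
  then show ?thesis
    by (simp add: det_mult[of _ n] det_mat_diag mult_carrier_mat[of _ n n])
qed

lemma mat_delete_0_0:
  "mat_delete (mat n n (\<lambda>(i, j). f i j)) 0 0 = mat (n - 1) (n - 1) (\<lambda>(i, j). f (Suc i) (Suc j))"
  by (rule eq_matI) (auto simp: mat_delete_def)

text \<open>The cofactors of row 0 do not see the changed entry, so expansion along that row is
  affine in it. This absorbs the correction of the Jacobi sum at \<open>i = j = 0\<close>.\<close>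

lemma det_add_corner:
  fixes f :: "nat \<Rightarrow> nat \<Rightarrow> 'a :: comm_ring_1"
  assumes "n > 0"
  shows "det (mat n n (\<lambda>(i, j). f i j + (if i = 0 \<and> j = 0 then c else 0))) =
    det (mat n n (\<lambda>(i, j). f i j)) + c * det (mat (n - 1) (n - 1) (\<lambda>(i, j). f (Suc i) (Suc j)))"
proof -
  define A B where "A = mat n n (\<lambda>(i, j). f i j)"
    and "B = mat n n (\<lambda>(i, j). f i j + (if i = 0 \<and> j = 0 then c else 0))"
  have AB: "A \<in> carrier_mat n n" "B \<in> carrier_mat n n" by (simp_all add: A_def B_def)
  have cof: "cofactor B 0 j = cofactor A 0 j" for j
  proof -
    have "mat_delete B 0 j = mat_delete A 0 j"
      by (rule eq_matI) (auto simp: A_def B_def mat_delete_def)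
    then show ?thesis by (simp add: cofactor_def)
  qed
  have "det B = (\<Sum>j<n. B $$ (0, j) * cofactor A 0 j)"
    using laplace_expansion_row[OF AB(2) assms] by (simp add: cof)
  also have "\<dots> = (\<Sum>j<n. A $$ (0, j) * cofactor A 0 j + (if j = 0 then c * cofactor A 0 0 else 0))"
    using assms by (intro sum.cong) (auto simp: A_def B_def algebra_simps)
  also have "\<dots> = det A + c * cofactor A 0 0"
    using assms laplace_expansion_row[OF AB(1) assms] by (simp add: sum.distrib)
  also have "cofactor A 0 0 = det (mat (n - 1) (n - 1) (\<lambda>(i, j). f (Suc i) (Suc j)))"
    by (simp add: cofactor_def A_def mat_delete_0_0)
  finally show ?thesis by (simp add: A_def B_def)
qed

definition reversal_mat :: "nat \<Rightarrow> 'a :: comm_ring_1 mat" where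
  "reversal_mat n = mat n n (\<lambda>(i, j). if i + j + 1 = n then 1 else 0)"

text \<open>The first row has its only nonzero entry in the last column, so each expansion step
  contributes \<open>(-1) ^ m\<close>, and these exponents add up to a triangular number.\<close>

lemma det_reversal_mat: "det (reversal_mat n :: 'a :: comm_ring_1 mat) = (-1) ^ (n * (n - 1) div 2)"
proof (induction n)
  case 0
  show ?case by (simp add: reversal_mat_def)
next
  case (Suc m)
  let ?A = "reversal_mat (Suc m) :: 'a mat"
  have A: "?A \<in> carrier_mat (Suc m) (Suc m)" by (simp add: reversal_mat_def)
  have del: "mat_delete ?A 0 m = reversal_mat m"
    by (rule eq_matI) (auto simp: mat_delete_def reversal_mat_def)
  have "det ?A = (\<Sum>j<Suc m. ?A $$ (0, j) * cofactor ?A 0 j)"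
    by (rule laplace_expansion_row[OF A]) simp
  also have "\<dots> = (\<Sum>j<Suc m. if j = m then cofactor ?A 0 m else 0)"
    by (intro sum.cong) (auto simp: reversal_mat_def)
  also have "\<dots> = cofactor ?A 0 m" by simp
  also have "\<dots> = (-1) ^ (m + m * (m - 1) div 2)"
    by (simp add: cofactor_def del Suc.IH power_add)
  also have "m + m * (m - 1) div 2 = (m * (m - 1) + 2 * m) div 2" by simp
  also have "m * (m - 1) + 2 * m = Suc m * (Suc m - 1)" by (cases m) simp_all
  finally show ?case .
qed

section \<open>Fourier matrices: orthogonality and the square of the determinant\<close>

definition fourier_mat :: "nat \<Rightarrow> 'a :: field \<Rightarrow> 'a mat" where
  "fourier_mat n w = mat n n (\<lambda>(i, j). w ^ (i * j))"

lemma fourier_mat_carrier [simp]: "fourier_mat n w \<in> carrier_mat n n"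
  by (simp add: fourier_mat_def)

lemma primitive_root_inverse:
  "primitive_root_of_unity n (inverse w) \<longleftrightarrow> primitive_root_of_unity n w"
  by (auto simp: primitive_root_of_unity_def power_inverse)

text \<open>A geometric sum with ratio \<open>w ^ i / w ^ j\<close>, whose \<open>n\<close>-th power
  is 1; primitivity makes the ratio differ from 1 unless \<open>i = j\<close>.\<close>

lemma primitive_root_sum:
  assumes w: "primitive_root_of_unity n w" and ij: "i < n" "j < n"
  shows "(\<Sum>t<n. w ^ (i * t) * inverse w ^ (t * j)) = (if i = j then of_nat n else 0)"
proof -
  have w1: "w ^ n = 1" and wl: "\<And>l. 0 < l \<Longrightarrow> l < n \<Longrightarrow> w ^ l \<noteq> 1"
    using w by (auto simp: primitive_root_of_unity_def)
  have w0: "w \<noteq> 0" using w1 ij by (auto simp: power_0_left)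
  define r where "r = w ^ i / w ^ j"
  have "(\<Sum>t<n. w ^ (i * t) * inverse w ^ (t * j)) = (\<Sum>t<n. r ^ t)"
  proof (rule sum.cong)
    fix t
    have "r ^ t = w ^ (t * i) / w ^ (t * j)"
      by (simp add: r_def power_divide flip: power_mult) (simp add: mult.commute)
    then show "w ^ (i * t) * inverse w ^ (t * j) = r ^ t"
      by (simp add: power_inverse divide_inverse mult.commute[of i])
  qed simp
  also have "\<dots> = (if i = j then of_nat n else 0)"
  proof (cases "i = j")
    case True
    then show ?thesis using w0 by (simp add: r_def)
  next
    case False
    have "r \<noteq> 1"
    proof
      assume "r = 1"
      then have eq: "w ^ i = w ^ j" using w0 by (simp add: r_def)
      have "w ^ (max i j - min i j) = 1"
        using eq w0 by (cases i j rule: linorder_cases) (simp_all add: power_diff)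
      moreover have "0 < max i j - min i j" "max i j - min i j < n"
        using False ij by auto
      ultimately show False using wl by blast
    qed
    moreover have "r ^ n = 1"
      by (simp add: r_def power_divide mult.commute[of _ n] power_mult w1 flip: power_mult[of w _ n])
    ultimately show ?thesis using False by (simp add: geometric_sum)
  qed
  finally show ?thesis .
qed

lemma fourier_mat_inverse:
  assumes "primitive_root_of_unity n w"
  shows "fourier_mat n w * fourier_mat n (inverse w) = of_nat n \<cdot>\<^sub>m 1\<^sub>m n"
  by (rule eq_matI)
    (auto simp: fourier_mat_def scalar_prod_def atLeast0LessThan primitive_root_sum[OF assms])

text \<open>For \<open>n = 2 * m\<close> primitivity gives \<open>w ^ m = -1\<close>; for odd
  \<open>n\<close> the exponent is a multiple of \<open>n\<close>. The value is used for the product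
  of the column factors when a Fourier matrix is reversed.\<close>

lemma primitive_root_power_triangle:
  assumes w: "primitive_root_of_unity n w" and n: "n > 0"
  shows "w ^ (n * (n - 1) div 2) = (-1) ^ (n - 1)"
proof (cases "even n")
  case True
  then obtain m where m: "n = 2 * m" by auto
  have "(w ^ m)\<^sup>2 = 1"
    using w by (simp add: primitive_root_of_unity_def m flip: power_mult) (simp add: mult.commute)
  moreover have "w ^ m \<noteq> 1"
    using w n by (auto simp: primitive_root_of_unity_def m)
  ultimately have "w ^ m = -1" by (simp add: power2_eq_1_iff)
  moreover have "n * (n - 1) div 2 = m * (n - 1)" by (simp add: m)
  ultimately show ?thesis by (simp add: power_mult)
next
  case False
  then obtain m where m: "n = 2 * m + 1" by (auto elim: oddE)
  have "n * (n - 1) div 2 = n * m" by (simp add: m)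
  then have "w ^ (n * (n - 1) div 2) = (w ^ n) ^ m" by (simp only: power_mult)
  then show ?thesis
    using w by (simp add: primitive_root_of_unity_def) (simp add: m)
qed

text \<open>Reversing the rows of the Fourier matrix yields the matrix of the inverse root up to column
  factors. This determines the sign of \<open>(det F)\<^sup>2\<close>.\<close>

lemma det_fourier_mat_square:
  assumes w: "primitive_root_of_unity n w" and n: "n > 0"
  shows "(det (fourier_mat n w))\<^sup>2 = (-1) ^ (n * (n - 1) div 2 + (n - 1)) * of_nat n ^ n"
proof -
  let ?T = "n * (n - 1) div 2"
  define F where "F = fourier_mat n w"
  define F' where "F' = fourier_mat n (inverse w)"
  have w1: "w ^ n = 1" using w by (simp add: primitive_root_of_unity_def)
  have w0: "w \<noteq> 0" using w1 n by (auto simp: power_0_left)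
  have carr: "F \<in> carrier_mat n n" "F' \<in> carrier_mat n n" "reversal_mat n \<in> carrier_mat n n"
    by (simp_all add: F_def F'_def reversal_mat_def)
  have "reversal_mat n * F = F' * mat_diag n (\<lambda>j. inverse w ^ j)"
  proof (rule eq_matI)
    fix i j assume "i < dim_row (F' * mat_diag n (\<lambda>j. inverse w ^ j))"
      "j < dim_col (F' * mat_diag n (\<lambda>j. inverse w ^ j))"
    then have ij: "i < n" "j < n" by (simp_all add: F'_def fourier_mat_def mat_diag_def)
    have "(reversal_mat n * F) $$ (i, j) = (\<Sum>l<n. (if i + l + 1 = n then 1 else 0) * w ^ (l * j))"
      using ij by (simp add: reversal_mat_def F_def fourier_mat_def scalar_prod_def atLeast0LessThan)
    also have "\<dots> = (\<Sum>l<n. if l = n - 1 - i then w ^ (l * j) else 0)"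
      using ij by (intro sum.cong) auto
    also have "\<dots> = w ^ ((n - 1 - i) * j)" using ij by simp
    also have "\<dots> = inverse w ^ (i * j) * inverse w ^ j"
    proof -
      have "(n - 1 - i) * j + i * j + j = n * j"
        using ij by (metis add_mult_distrib Suc_pred' le_add_diff_inverse2 less_Suc_eq_le mult_Suc
            add.assoc add.commute n)
      then have "w ^ ((n - 1 - i) * j) * (w ^ (i * j) * w ^ j) = (w ^ n) ^ j"
        by (simp add: add.assoc flip: power_add power_mult)
      then show ?thesis
        using w0 w1 by (simp add: field_simps power_inverse)
    qed
    also have "\<dots> = (F' * mat_diag n (\<lambda>j. inverse w ^ j)) $$ (i, j)"
      using ij by (simp add: mat_diag_mult_right[OF carr(2)]) (simp add: F'_def fourier_mat_def)
    finally show "(reversal_mat n * F) $$ (i, j) = (F' * mat_diag n (\<lambda>j. inverse w ^ j)) $$ (i, j)" .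
  qed (simp_all add: reversal_mat_def F_def F'_def fourier_mat_def mat_diag_def)
  then have "det (reversal_mat n * F) = det F' * det (mat_diag n (\<lambda>j. inverse w ^ j))"
    by (simp add: det_mult[OF carr(2)])
  moreover have "det (mat_diag n (\<lambda>j. inverse w ^ j)) = (-1) ^ (n - 1)"
  proof -
    have "(\<Prod>j<n. inverse w ^ j) = inverse w ^ (\<Sum>j<n. j)"
      by (simp add: power_sum)
    also have "(\<Sum>j<n. j) = ?T"
      using Sum_Ico_nat[of 0 n] by (simp add: atLeast0LessThan)
    finally show ?thesis
      using primitive_root_power_triangle[of n "inverse w"] w n
      by (simp add: det_mat_diag primitive_root_inverse)
  qed
  ultimately have "(-1) ^ ?T * det F = det F' * (-1) ^ (n - 1)"
    by (simp add: det_mult[OF carr(3,1)] det_reversal_mat)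
  then have "(-1) ^ ?T * ((-1) ^ ?T * det F) = (-1) ^ ?T * (det F' * (-1) ^ (n - 1))"
    by simp
  then have F: "det F = (-1) ^ (?T + (n - 1)) * det F'"
    by (simp add: power_add flip: mult.assoc power_mult_distrib)
  \<comment> \<open>Orthogonality gives only this mixed product; the relation between
    \<open>det F\<close> and \<open>det F'\<close> turns it into the square.\<close>
  have "det F * det F' = of_nat n ^ n"
    using arg_cong[OF fourier_mat_inverse[OF w], of det]
    by (simp add: F_def F'_def det_mult[of _ n])
  then have "det F * ((-1) ^ (?T + (n - 1)) * det F') = (-1) ^ (?T + (n - 1)) * of_nat n ^ n"
    by simp
  then show ?thesis
    by (simp only: F[symmetric] power2_eq_square F_def)
qed

section \<open>Factorisation, determinant and minor of the Hankel matrix\<close>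

definition hankel_fourier :: "nat \<Rightarrow> 'a :: field \<Rightarrow> (nat \<Rightarrow> 'a) \<Rightarrow> nat \<Rightarrow> 'a" where
  "hankel_fourier n w \<eta> m = (\<Sum>t<n. w ^ (m * t) * \<eta> t)"

definition hankel_mat :: "nat \<Rightarrow> 'a :: field \<Rightarrow> (nat \<Rightarrow> 'a) \<Rightarrow> 'a mat" where
  "hankel_mat n w \<eta> = mat n n (\<lambda>(i, j). hankel_fourier n w \<eta> (i + j))"

lemma hankel_mat_eq: "hankel_mat n w \<eta> = fourier_mat n w * mat_diag n \<eta> * fourier_mat n w"
  by (subst mat_diag_mult_right[of _ n n], simp)
    (rule eq_matI, auto simp: hankel_mat_def hankel_fourier_def fourier_mat_def scalar_prod_def
      atLeast0LessThan algebra_simps power_add intro!: sum.cong)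

lemma det_hankel_mat:
  assumes "primitive_root_of_unity n w" "n > 0"
  shows "det (hankel_mat n w \<eta>) =
    (-1) ^ (n * (n - 1) div 2 + (n - 1)) * of_nat n ^ n * (\<Prod>t<n. \<eta> t)"
proof -
  have "det (hankel_mat n w \<eta>) = (det (fourier_mat n w))\<^sup>2 * (\<Prod>t<n. \<eta> t)"
    by (simp add: hankel_mat_eq det_mult[of _ n] mult_carrier_mat[of _ n n] det_mat_diag
        power2_eq_square)
  then show ?thesis by (simp only: det_fourier_mat_square[OF assms])
qed

lemma det_hankel_minor:
  assumes w: "primitive_root_of_unity n w" and n: "n > 0" and \<eta>: "\<And>t. t < n \<Longrightarrow> \<eta> t \<noteq> 0"
  shows "of_nat n ^ 2 * det (mat (n - 1) (n - 1) (\<lambda>(i, j). hankel_fourier n w \<eta> (Suc i + Suc j))) =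
    det (hankel_mat n w \<eta>) * (\<Sum>t<n. 1 / \<eta> t)"
proof -
  define M where "M = hankel_mat n w \<eta>"
  define K where "K = hankel_mat n (inverse w) (\<lambda>t. 1 / \<eta> t)"
  let ?F = "fourier_mat n w" and ?F' = "fourier_mat n (inverse w)"
  let ?D = "mat_diag n \<eta>" and ?D' = "mat_diag n (\<lambda>t. 1 / \<eta> t)"
  let ?N = "of_nat n :: complex"
  have M: "M \<in> carrier_mat n n" and K: "K \<in> carrier_mat n n"
    by (simp_all add: M_def K_def hankel_mat_def)
  have DD: "?D * ?D' = 1\<^sub>m n"
    by (subst mat_diag_mult_left[of _ n n], simp) (rule eq_matI, auto simp: mat_diag_def \<eta>)
  \<comment> \<open>The product telescopes: \<open>?F * ?F'\<close> collapses to a scalar first in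
    the middle and, once the diagonal matrices cancel, again on the outside.\<close>
  have "M * K = ?F * (?D * ((?F * ?F') * (?D' * ?F')))"
    unfolding M_def K_def hankel_mat_eq
    by (simp add: assoc_mult_mat[of _ n n _ n _ n] mult_carrier_mat[of _ n n])
  also have "\<dots> = ?F * (?D * (?N \<cdot>\<^sub>m (?D' * ?F')))"
    by (simp add: fourier_mat_inverse[OF w] mult_carrier_mat[of _ n n] mult_smult_assoc_mat[of _ n n _ n]
       left_mult_one_mat[of _ n n])
  also have "\<dots> = ?N \<cdot>\<^sub>m (?F * ((?D * ?D') * ?F'))"
    by (simp del: mat_diag_diag add: mult_smult_distrib[of _ n n _ n] assoc_mult_mat[of _ n n _ n _ n]
        mult_carrier_mat[of _ n n])
  also have "\<dots> = ?N \<cdot>\<^sub>m (?N \<cdot>\<^sub>m 1\<^sub>m n)"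
    by (simp del: mat_diag_diag add: DD fourier_mat_inverse[OF w] left_mult_one_mat[of _ n n])
  also have "\<dots> = ?N ^ 2 \<cdot>\<^sub>m 1\<^sub>m n"
    by (rule eq_matI) (auto simp: power2_eq_square)
  finally have MK: "M * K = ?N ^ 2 \<cdot>\<^sub>m 1\<^sub>m n" .
  note adj = adj_mat[OF M]
  \<comment> \<open>Passing through the adjugate yields the cofactor without dividing by
    \<open>det M\<close>; only the entry at \<open>(0, 0)\<close> is read off.\<close>
  have "?N ^ 2 \<cdot>\<^sub>m adj_mat M = adj_mat M * (M * K)"
    unfolding MK using adj(1) by (simp add: mult_smult_distrib[of _ n n _ n])
  also have "\<dots> = (adj_mat M * M) * K"
    using adj(1) M K by (simp add: assoc_mult_mat[of _ n n _ n _ n])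
  also have "\<dots> = det M \<cdot>\<^sub>m K"
    unfolding adj(3) using K by (simp add: mult_smult_assoc_mat[of _ n n _ n])
  finally have "(?N ^ 2 \<cdot>\<^sub>m adj_mat M) $$ (0, 0) = (det M \<cdot>\<^sub>m K) $$ (0, 0)" by simp
  then have "?N ^ 2 * cofactor M 0 0 = det M * K $$ (0, 0)"
    using M K n by (simp add: adj_mat_def)
  moreover have "K $$ (0, 0) = (\<Sum>t<n. 1 / \<eta> t)"
    using n by (simp add: K_def hankel_mat_def hankel_fourier_def)
  moreover have "cofactor M 0 0 =
      det (mat (n - 1) (n - 1) (\<lambda>(i, j). hankel_fourier n w \<eta> (Suc i + Suc j)))"
    by (simp add: cofactor_def M_def hankel_mat_def mat_delete_0_0)
  ultimately show ?thesis by (simp add: M_def)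
qed

section \<open>Gauss and Jacobi sums\<close>

lemma mult_char_one: "mult_char A \<Longrightarrow> A 1 = 1"
  unfolding mult_char_def by (metis mult_1 mult_cancel_right1 zero_neq_one)

lemma mult_char_mult: "mult_char A \<Longrightarrow> A (x * y) = A x * A y"
  by (cases "x = 0 \<or> y = 0") (auto simp: mult_char_def)

lemma mult_char_power:
  assumes "mult_char A"
  shows "A (x ^ j) = A x ^ j"
  by (induction j) (simp_all add: mult_char_one mult_char_mult assms)

text \<open>Terms are grouped by \<open>t = x + y\<close>. For nonzero \<open>t\<close> the
  substitution of \<open>t * x\<close> for \<open>x\<close> splits off a Jacobi sum;
  \<open>t = 0\<close> produces the last summand.\<close>

lemma gauss_sum_mult:
  fixes A B :: "'p::prime_card mod_ring \<Rightarrow> complex"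
  assumes z: "z ^ CARD('p) = 1" and A: "mult_char A" and B: "mult_char B"
  shows "gauss_sum z A * gauss_sum z B =
    jacobi_sum A B * gauss_sum z (\<lambda>x. A x * B x) + B (-1) * (\<Sum>x\<in>UNIV. A x * B x)"
proof -
  define S where "S t = (\<Sum>x\<in>UNIV. A x * B (t - x))" for t
  have "gauss_sum z A * gauss_sum z B = (\<Sum>x\<in>UNIV. \<Sum>y\<in>UNIV. A x * B y * root_pow z (x + y))"
    by (simp add: gauss_sum_def sum_product root_pow_add[OF z] ac_simps)
  also have "\<dots> = (\<Sum>x\<in>UNIV. \<Sum>t\<in>UNIV. A x * B (t - x) * root_pow z t)"
  proof (rule sum.cong)
    fix x :: "'p mod_ring"
    show "(\<Sum>y\<in>UNIV. A x * B y * root_pow z (x + y)) = (\<Sum>t\<in>UNIV. A x * B (t - x) * root_pow z t)"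
      by (rule sum.reindex_bij_witness[of _ "\<lambda>t. t - x" "\<lambda>y. x + y"]) auto
  qed simp
  also have "\<dots> = (\<Sum>t\<in>UNIV. S t * root_pow z t)"
    unfolding S_def sum_distrib_right by (rule sum.swap)
  also have "\<dots> = S 0 + (\<Sum>t\<in>UNIV - {0}. S t * root_pow z t)"
    by (subst sum.remove[of _ 0]) simp_all
  also have "S 0 = B (-1) * (\<Sum>x\<in>UNIV. A x * B x)"
    unfolding S_def sum_distrib_left
  proof (rule sum.cong)
    fix x :: "'p mod_ring"
    have "B (- x) = B (-1) * B x"
      using mult_char_mult[OF B, of "-1" x] by simp
    then show "A x * B (0 - x) = B (-1) * (A x * B x)" by simp
  qed simp
  also have "(\<Sum>t\<in>UNIV - {0}. S t * root_pow z t) =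
      (\<Sum>t\<in>UNIV - {0}. jacobi_sum A B * (A t * B t * root_pow z t))"
  proof (rule sum.cong)
    fix t :: "'p mod_ring" assume t: "t \<in> UNIV - {0}"
    have "S t = (\<Sum>x\<in>UNIV. A (t * x) * B (t * (1 - x)))"
      unfolding S_def
      by (rule sum.reindex_bij_witness[of _ "\<lambda>x. t * x" "\<lambda>x. x / t"])
        (use t in \<open>auto simp: algebra_simps\<close>)
    also have "\<dots> = A t * B t * jacobi_sum A B"
      by (simp add: mult_char_mult A B jacobi_sum_def sum_distrib_left ac_simps)
    finally show "S t * root_pow z t = jacobi_sum A B * (A t * B t * root_pow z t)" by simp
  qed simp
  also have "\<dots> = (\<Sum>t\<in>UNIV. jacobi_sum A B * (A t * B t * root_pow z t))"
    using A by (intro sum.mono_neutral_left) (auto simp: mult_char_def)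
  also have "\<dots> = jacobi_sum A B * gauss_sum z (\<lambda>x. A x * B x)"
    by (simp add: gauss_sum_def sum_distrib_left)
  finally show ?thesis by simp
qed

text \<open>Replacing \<open>x\<close> by \<open>y * x\<close> cancels the characters of
  \<open>y\<close>. The remaining sum over nonzero \<open>y\<close> is \<open>p - 1\<close> at
  \<open>x = -1\<close> and -1 elsewhere, and the constant -1 drops out because the values of
  \<open>A\<close> sum to 0.\<close>

lemma gauss_sum_inverse_char:
  fixes A B :: "'p::prime_card mod_ring \<Rightarrow> complex"
  assumes z: "z ^ CARD('p) = 1" "z \<noteq> 1" and A: "mult_char A" and B: "mult_char B"
    and AB: "\<And>x. x \<noteq> 0 \<Longrightarrow> A x * B x = 1" and A0: "(\<Sum>x\<in>UNIV. A x) = 0"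
  shows "gauss_sum z A * gauss_sum z B = A (-1) * of_nat CARD('p)"
proof -
  have inner: "(\<Sum>y\<in>UNIV - {0}. root_pow z (y * (1 + x))) = (if x = -1 then of_nat CARD('p) else 0) - 1"
    for x :: "'p mod_ring"
  proof -
    have "(\<Sum>y\<in>UNIV - {0}. root_pow z (y * (1 + x))) = (\<Sum>y\<in>UNIV. root_pow z ((1 + x) * y)) - 1"
      by (simp add: sum_diff1 mult.commute)
    moreover have "1 + x = 0 \<longleftrightarrow> x = -1"
      by (metis add.commute eq_neg_iff_add_eq_0)
    ultimately show ?thesis
      using sum_root_pow[OF z, of "1 + x"] by auto
  qed
  have "gauss_sum z A * gauss_sum z B = (\<Sum>x\<in>UNIV. \<Sum>y\<in>UNIV. A x * B y * root_pow z (x + y))"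
    by (simp add: gauss_sum_def sum_product root_pow_add[OF z(1)] ac_simps)
  also have "\<dots> = (\<Sum>y\<in>UNIV. \<Sum>x\<in>UNIV. A x * B y * root_pow z (x + y))"
    by (rule sum.swap)
  also have "\<dots> = (\<Sum>y\<in>UNIV - {0}. \<Sum>x\<in>UNIV. A x * B y * root_pow z (x + y))"
    using B by (intro sum.mono_neutral_right) (auto simp: mult_char_def)
  also have "\<dots> = (\<Sum>y\<in>UNIV - {0}. \<Sum>x\<in>UNIV. A x * root_pow z (y * (1 + x)))"
  proof (rule sum.cong)
    fix y :: "'p mod_ring" assume y: "y \<in> UNIV - {0}"
    have "(\<Sum>x\<in>UNIV. A x * B y * root_pow z (x + y)) =
        (\<Sum>x\<in>UNIV. A (y * x) * B y * root_pow z (y * x + y))"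
      by (rule sum.reindex_bij_witness[of _ "\<lambda>x. y * x" "\<lambda>x. x / y"])
        (use y in auto)
    also have "\<dots> = (\<Sum>x\<in>UNIV. (A y * B y) * A x * root_pow z (y * (1 + x)))"
      by (simp add: mult_char_mult A algebra_simps)
    finally show "(\<Sum>x\<in>UNIV. A x * B y * root_pow z (x + y)) =
        (\<Sum>x\<in>UNIV. A x * root_pow z (y * (1 + x)))"
      using y by (simp add: AB)
  qed simp
  also have "\<dots> = (\<Sum>x\<in>UNIV. A x * (\<Sum>y\<in>UNIV - {0}. root_pow z (y * (1 + x))))"
    unfolding sum_distrib_left by (rule sum.swap)
  also have "\<dots> = (\<Sum>x\<in>UNIV. (if x = -1 then A x * of_nat CARD('p) else 0)) - (\<Sum>x\<in>UNIV. A x)"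
    unfolding inner sum_subtractf[symmetric] by (rule sum.cong) (auto simp: right_diff_distrib)
  also have "\<dots> = A (-1) * of_nat CARD('p)"
    by (simp add: A0)
  finally show ?thesis .
qed

section \<open>The order of the value of a generating character at a generator\<close>

lemma primitive_root_power_eq_1_iff:
  assumes "primitive_root_of_unity n w" "n > 0"
  shows "w ^ m = 1 \<longleftrightarrow> n dvd m"
proof -
  have w1: "w ^ n = 1" using assms by (simp add: primitive_root_of_unity_def)
  have "w ^ m = w ^ (n * (m div n) + m mod n)" by simp
  also have "\<dots> = w ^ (m mod n)" unfolding power_add power_mult w1 by simp
  finally have "w ^ m = w ^ (m mod n)" .
  then show ?thesis
    using assms by (cases "m mod n = 0") (auto simp: primitive_root_of_unity_def dvd_eq_mod_eq_0)
qed

text \<open>If \<open>\<chi> g ^ l = 1\<close>, then \<open>A g ^ l = 1\<close> for every character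
  \<open>A\<close>, as \<open>\<chi>\<close> generates them all. The character that sends
  \<open>g\<close> to a primitive complex root of unity of order \<open>k * n\<close> refutes this
  for \<open>0 < l < k * n\<close>.\<close>

lemma (in gauss_periods) char_generator_value:
  assumes "char_generator \<chi>"
  shows "primitive_root_of_unity (k * n) (\<chi> g)"
  unfolding primitive_root_of_unity_def
proof (intro conjI allI impI)
  have \<chi>: "mult_char \<chi>" and gen: "generate char_group {\<chi>} = carrier char_group"
    using assms by (auto simp: char_generator_def char_group_def)
  show "\<chi> g ^ (k * n) = 1"
    by (simp add: mult_char_one[OF \<chi>] generator_power_one flip: mult_char_power[OF \<chi>])
  fix l assume l: "0 < l" "l < k * n"
  show "\<chi> g ^ l \<noteq> 1"
  proof
    assume one: "\<chi> g ^ l = 1"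
    interpret G: comm_group "char_group :: ('p mod_ring \<Rightarrow> complex) monoid"
      by (rule comm_group_char_group)
    have all: "A g ^ l = 1" if "A \<in> generate char_group {\<chi>}" for A
      using that
    proof (induction rule: generate.induct)
      case one
      then show ?case using g_nonzero by (simp add: char_group_def trivial_char_def)
    next
      case (incl h)
      then show ?case using one by simp
    next
      case (inv h)
      then have "(inv\<^bsub>char_group\<^esub> \<chi>) \<otimes>\<^bsub>char_group\<^esub> \<chi> = \<one>\<^bsub>char_group\<^esub>"
        using \<chi> by (intro G.l_inv) (simp add: char_group_def)
      then have "(inv\<^bsub>char_group\<^esub> \<chi>) g * \<chi> g = 1"
        using g_nonzero by (simp add: char_group_def trivial_char_def fun_eq_iff)
      then have "(inv\<^bsub>char_group\<^esub> \<chi>) g ^ l * \<chi> g ^ l = 1"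
        by (simp flip: power_mult_distrib)
      then show ?case using one inv by simp
    next
      case (eng h1 h2)
      then show ?case by (simp add: char_group_def power_mult_distrib)
    qed
    define z where "z = cis (2 * pi / real (k * n))"
    have z: "z ^ j = cis (2 * pi * real j / real (k * n))" for j
      by (simp add: z_def DeMoivre mult.commute)
    have z1: "z ^ (k * n) = 1"
      using kn_pos by (simp add: z)
    have zl: "z ^ l \<noteq> 1"
    proof
      assume "z ^ l = 1"
      then have "cos (2 * pi * real l / real (k * n)) = 1"
        by (simp add: z complex_eq_iff)
      then obtain m :: int where "2 * pi * real l / real (k * n) = m * 2 * pi"
        by (auto simp: cos_one_2pi_int)
      then have "real l = m * real (k * n)"
        using kn_pos by (simp add: field_simps)
      then have "int l = m * int (k * n)"
        by (metis of_int_eq_iff of_int_mult of_int_of_nat_eq)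
      then have "int (k * n) dvd int l" by simp
      then show False using l by (auto dest: zdvd_imp_le simp del: of_nat_mult)
    qed
    have zmod: "z ^ j = z ^ (j mod (k * n))" for j
    proof -
      have "z ^ j = z ^ (k * n * (j div (k * n)) + j mod (k * n))" by simp
      also have "\<dots> = z ^ (j mod (k * n))"
        unfolding power_add power_mult[of z "k * n"] z1 by simp
      finally show ?thesis .
    qed
    have zeq: "z ^ i = z ^ j" if "g ^ i = g ^ j" for i j
      using that zmod generator_power_eq_iff by metis
    \<comment> \<open>A discrete logarithm, determined only modulo \<open>k * n\<close>; since
      \<open>z ^ (k * n) = 1\<close>, the choice does not affect \<open>z ^ lg x\<close>.\<close>
    define lg where "lg x = (SOME j. x = g ^ j)" for x
    have lg: "g ^ lg x = x" if "x \<noteq> 0" for x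
      using someI_ex[OF generator[OF that]] by (simp add: lg_def)
    define A where "A x = (if x = 0 then 0 else z ^ lg x)" for x
    have "A (x * y) = A x * A y" if "x \<noteq> 0" "y \<noteq> 0" for x y
    proof -
      have "z ^ lg (x * y) = z ^ (lg x + lg y)"
        by (rule zeq) (simp add: lg that power_add)
      then show ?thesis using that by (simp add: A_def power_add)
    qed
    then have "mult_char A"
      by (auto simp: mult_char_def) (auto simp: A_def z_def)
    then have "A \<in> generate char_group {\<chi>}"
      unfolding gen by (simp add: char_group_def)
    then have "A g ^ l = 1" by (rule all)
    moreover have "z ^ lg g = z ^ 1"
      by (rule zeq) (simp add: lg g_nonzero)
    then have "A g = z"
      using g_nonzero by (simp add: A_def)
    ultimately show False using zl by simp
  qed
qed

section \<open>Gauss and Jacobi sums of the powers of the \<open>k\<close>-th power of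
  \<open>\<chi>\<close>\<close>

locale gauss_characters = gauss_periods +
  fixes \<chi> :: "'a mod_ring \<Rightarrow> complex"
  assumes char_gen: "char_generator \<chi>"
begin

definition \<omega> :: complex where "\<omega> = \<chi> g ^ k"

definition \<psi> :: "nat \<Rightarrow> 'a mod_ring \<Rightarrow> complex" where "\<psi> m = char_pow \<chi> (k * m)"

definition G :: "nat \<Rightarrow> complex" where "G m = gauss_sum \<zeta> (\<psi> m)"

text \<open>The Gauss sum of the inverse of \<open>\<psi> m\<close>; inverting the root of unity
  keeps the indices natural numbers.\<close>

definition G' :: "nat \<Rightarrow> complex" where
  "G' m = hankel_fourier n (inverse \<omega>) (\<lambda>t. period (g ^ t)) m"

text \<open>The value of \<open>\<psi> 1\<close> at -1, because
  \<open>\<chi> (-1) = -1\<close>.\<close>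

definition \<sigma> :: complex where "\<sigma> = (-1) ^ k"

lemma mult_char: "mult_char \<chi>"
  using char_gen by (simp add: char_generator_def char_group_def)

lemma \<psi>_eq: "\<psi> m x = (if x = 0 then 0 else \<chi> x ^ (k * m))"
  by (simp add: \<psi>_def char_pow_eq[OF mult_char])

lemma mult_char_\<psi>: "mult_char (\<psi> m)"
  using mult_char by (auto simp: mult_char_def \<psi>_eq power_mult_distrib)

lemma \<psi>_mult: "\<psi> i x * \<psi> j x = \<psi> (i + j) x"
  by (simp add: \<psi>_eq distrib_left power_add)

lemma primitive_\<chi>: "primitive_root_of_unity (k * n) (\<chi> g)"
  by (rule char_generator_value[OF char_gen])

lemma primitive_\<omega>: "primitive_root_of_unity n \<omega>"
  unfolding primitive_root_of_unity_def \<omega>_def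
  using primitive_root_power_eq_1_iff[OF primitive_\<chi> kn_pos] k_pos
  by (auto simp flip: power_mult dest: dvd_imp_le)

lemma \<omega>_power_eq_1_iff: "\<omega> ^ m = 1 \<longleftrightarrow> n dvd m"
  using primitive_root_power_eq_1_iff[OF primitive_\<omega>] n_ge_2 by simp

lemma \<omega>_nonzero: "\<omega> \<noteq> 0"
  using \<omega>_power_eq_1_iff[of n] n_ge_2 by (auto simp: power_0_left)

lemma \<psi>_coset:
  assumes "u \<in> U"
  shows "\<psi> m (g ^ t * u) = \<omega> ^ (m * t)"
proof -
  have "\<chi> (g ^ t * u) ^ (k * m) = (\<chi> g ^ k) ^ (m * t) * \<chi> (u ^ k) ^ m"
    by (simp add: mult_char_mult[OF mult_char] mult_char_power[OF mult_char] power_mult_distrib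
        ac_simps flip: power_mult)
  also have "\<chi> (u ^ k) = 1"
    using assms mult_char_one[OF mult_char] by (simp add: U_iff)
  finally show ?thesis
    using g_nonzero U_nonzero[OF assms] by (simp add: \<psi>_eq \<omega>_def)
qed

lemma G_eq: "G m = hankel_fourier n \<omega> (\<lambda>t. period (g ^ t)) m"
proof -
  have "G m = (\<Sum>x\<in>UNIV - {0}. \<psi> m x * root_pow \<zeta> x)"
    unfolding G_def gauss_sum_def by (rule sum.mono_neutral_right) (auto simp: \<psi>_eq)
  also have "\<dots> = (\<Sum>t<n. \<Sum>u\<in>U. \<omega> ^ (m * t) * root_pow \<zeta> (g ^ t * u))"
    by (simp add: sum_nonzero_cosets \<psi>_coset)
  finally show ?thesis
    by (simp add: hankel_fourier_def period_def sum_distrib_left)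
qed

lemma G'_eq_G:
  assumes "n dvd i + j"
  shows "G' i = G j"
proof -
  have "\<omega> ^ (i * t) * \<omega> ^ (j * t) = 1" for t
    using assms by (simp add: \<omega>_power_eq_1_iff flip: power_add distrib_right)
  then have "inverse \<omega> ^ (i * t) = \<omega> ^ (j * t)" for t
    using \<omega>_nonzero by (metis inverse_unique power_inverse)
  then show ?thesis by (simp add: G'_def G_eq hankel_fourier_def)
qed

lemma G_trivial: "n dvd m \<Longrightarrow> G m = -1"
  using sum_periods[of 1] by (simp add: G_eq hankel_fourier_def power_mult \<omega>_power_eq_1_iff[THEN iffD2])

lemma G'_trivial: "n dvd m \<Longrightarrow> G' m = -1"
  using G'_eq_G[of m m] G_trivial[of m] by simp

lemma even_kn: "even (k * n)"
proof -
  have "CARD('a) = k * n + 1" using card_eq kn_pos by linarith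
  moreover have "CARD('a) > 2"
    using card_eq k_pos n_ge_2 mult_le_mono[of 1 k 2 n] by linarith
  ultimately show ?thesis
    using prime_odd_nat[OF prime_card[where 'a='a]] by simp
qed

lemma minus_one_neq_one: "(-1 :: 'a mod_ring) \<noteq> 1"
proof
  assume "(-1 :: 'a mod_ring) = 1"
  then have "(of_nat 2 :: 'a mod_ring) = 0"
    by (simp add: eq_neg_iff_add_eq_0) 
  then have "CARD('a) dvd 2" by (rule of_nat_0_mod_ring_dvd)
  then have "CARD('a) \<le> 2" by (auto dest: dvd_imp_le)
  then show False
    using card_eq k_pos n_ge_2 mult_le_mono[of 1 k 2 n] by linarith
qed

text \<open>The value squares to 1. It is not 1 because \<open>\<chi> g\<close> has the same order
  as \<open>g\<close>, so only the element 1 is mapped to 1.\<close>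

lemma \<chi>_minus_one: "\<chi> (-1) = -1"
proof -
  obtain j where j: "-1 = g ^ j" using generator[of "-1"] by auto
  have "(\<chi> (-1))\<^sup>2 = 1"
    by (simp add: mult_char_one[OF mult_char] flip: mult_char_power[OF mult_char])
  moreover have "\<chi> (-1) \<noteq> 1"
  proof
    assume "\<chi> (-1) = 1"
    then have "k * n dvd j"
      using primitive_root_power_eq_1_iff[OF primitive_\<chi> kn_pos]
      by (simp add: j mult_char_power[OF mult_char])
    then have "g ^ j = g ^ 0" by (subst generator_power_eq_iff) simp
    then show False using minus_one_neq_one by (simp add: j)
  qed
  ultimately show ?thesis by (simp add: power2_eq_1_iff)
qed

lemma \<psi>_minus_one: "\<psi> m (-1) = \<sigma> ^ m"
  by (simp add: \<psi>_eq \<chi>_minus_one \<sigma>_def power_mult)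

lemma \<sigma>_square: "\<sigma> ^ m * \<sigma> ^ m = 1"
  by (simp add: \<sigma>_def flip: power_mult_distrib)

lemma \<sigma>_n: "n dvd m \<Longrightarrow> \<sigma> ^ m = 1"
  using even_kn by (auto simp: \<sigma>_def simp flip: power_mult elim!: dvdE)

lemma \<psi>_trivial:
  assumes "n dvd m" "x \<noteq> 0"
  shows "\<psi> m x = 1"
proof -
  have "x \<in> (\<lambda>(t, u). g ^ t * u) ` ({..<n} \<times> U)"
    using assms(2) bij_betw_imp_surj_on[OF coset_bij] by simp
  then obtain t u where "u \<in> U" "x = g ^ t * u" by auto
  then show ?thesis using assms(1) by (simp add: \<psi>_coset \<omega>_power_eq_1_iff)
qed

lemma sum_\<psi>: "(\<Sum>x\<in>UNIV. \<psi> m x) = (if n dvd m then of_nat (k * n) else 0)"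
proof -
  have "(\<Sum>x\<in>UNIV. \<psi> m x) = (\<Sum>x\<in>UNIV - {0}. \<psi> m x)"
    by (rule sum.mono_neutral_right) (auto simp: \<psi>_eq)
  also have "\<dots> = (if n dvd m then of_nat (k * n) else 0)"
  proof (cases "n dvd m")
    case True
    have "(\<Sum>x\<in>UNIV - {0}. \<psi> m x) = (\<Sum>x\<in>UNIV - {0 :: 'a mod_ring}. 1)"
      by (rule sum.cong) (simp_all add: \<psi>_trivial True)
    then show ?thesis using True by (simp add: card_nonzero del: card_Diff_insert)
  next
    case False
    have "(\<Sum>x\<in>UNIV - {0}. \<psi> m x) = of_nat (card U) * (\<Sum>t<n. (\<omega> ^ m) ^ t)"
      by (simp add: sum_nonzero_cosets \<psi>_coset power_mult sum_distrib_left)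
    also have "(\<Sum>t<n. (\<omega> ^ m) ^ t) = 0"
      using False by (subst geometric_sum) (auto simp: \<omega>_power_eq_1_iff simp flip: power_mult)
    finally show ?thesis using False by simp
  qed
  finally show ?thesis .
qed

lemma G_mult_G':
  assumes "\<not> n dvd m"
  shows "G m * G' m = \<sigma> ^ m * of_nat CARD('a)"
proof -
  \<comment> \<open>A natural number congruent to \<open>- m\<close> modulo
    \<open>n\<close>.\<close>
  define m' where "m' = m * (n - 1)"
  have m': "m + m' = m * n" using n_ge_2 by (simp add: m'_def algebra_simps)
  have "\<psi> m x * \<psi> m' x = 1" if "x \<noteq> 0" for x
    by (simp add: \<psi>_mult m' \<psi>_trivial that)
  then have "G m * G m' = \<sigma> ^ m * of_nat CARD('a)"
    unfolding G_def \<psi>_minus_one[symmetric]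
    by (intro gauss_sum_inverse_char \<zeta>_power \<zeta>_neq_1 mult_char_\<psi>) (simp_all add: sum_\<psi> assms)
  moreover have "G' m = G m'" by (rule G'_eq_G) (simp add: m')
  ultimately show ?thesis by simp
qed

lemma G_mult_G:
  "G i * G j = jacobi_sum (\<psi> i) (\<psi> j) * G (i + j) +
     \<sigma> ^ j * (if n dvd i + j then of_nat (k * n) else 0)"
  using gauss_sum_mult[OF \<zeta>_power mult_char_\<psi> mult_char_\<psi>, of i j]
  by (simp add: \<psi>_mult \<psi>_minus_one sum_\<psi> G_def del: of_nat_mult)

text \<open>With \<open>G' m = G (-m)\<close> the formula \<open>J(A, B) = G(A) G(B) / G(AB)\<close> takes a shape that stays
  valid for \<open>AB\<close> trivial; only the pair of trivial characters needs a correction.\<close>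

lemma jacobi_eq:
  assumes "i < n" "j < n"
  shows "of_nat CARD('a) * jacobi_sum (\<psi> i) (\<psi> j) =
    (\<sigma> ^ i * G i) * G' (i + j) * (\<sigma> ^ j * G j) +
    (if i = 0 \<and> j = 0 then (of_nat CARD('a) - 1)\<^sup>2 else 0)"
proof -
  let ?J = "jacobi_sum (\<psi> i) (\<psi> j)" and ?p = "of_nat CARD('a) :: complex"
  have p: "of_nat (k * n) = ?p - 1"
    using card_eq kn_pos by (metis of_nat_diff of_nat_1 One_nat_def Suc_leI zero_less_card_finite)
  note gg = G_mult_G[of i j]
  consider "\<not> n dvd i + j" | "n dvd i + j" "i \<noteq> 0" | "i = 0" "j = 0"
    using assms by (metis add_cancel_left_left dvd_imp_le leD not_gr_zero add_0)
  then show ?thesis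
  proof cases
    case 1
    then have "G i * G j = ?J * G (i + j)" using gg by simp
    then have "\<sigma> ^ (i + j) * (G i * G j) * G' (i + j) = ?J * (G (i + j) * G' (i + j)) * \<sigma> ^ (i + j)"
      by simp
    also have "\<dots> = ?J * ?p"
      using \<sigma>_square[of "i + j"] by (simp add: G_mult_G'[OF 1] ac_simps)
    finally show ?thesis
      using 1 by (auto simp: power_add ac_simps)
  next
    case 2
    have ni: "\<not> n dvd i" using 2 assms by (auto dest: dvd_imp_le)
    have "\<sigma> ^ i * \<sigma> ^ j = 1" using \<sigma>_n[OF 2(1)] by (simp add: power_add)
    then have s: "\<sigma> ^ j = \<sigma> ^ i" using \<sigma>_square[of i]
      by (metis mult.right_neutral mult.left_commute)
    have "G' i = G j" by (rule G'_eq_G[OF 2(1)])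
    then have Gij: "G i * G j = \<sigma> ^ i * ?p" using G_mult_G'[OF ni] by simp
    have "?J = - (\<sigma> ^ i)"
      using gg 2
      by (simp add: Gij G_trivial s p algebra_simps eq_neg_iff_add_eq_0 del: of_nat_mult)
    moreover have "(\<sigma> ^ i * G i) * G' (i + j) * (\<sigma> ^ j * G j) = - (\<sigma> ^ i * \<sigma> ^ i * (G i * G j))"
      using 2 by (simp add: G'_trivial s ac_simps)
    ultimately show ?thesis
      using 2 by (simp add: Gij \<sigma>_square ac_simps)
  next
    case 3
    \<comment> \<open>The product of the three trivial Gauss sums is -1, and
      \<open>?p * (?p - 2) = (?p - 1) ^ 2 - 1\<close>; this is where the correction comes
      from.\<close>
    then have J: "?J = ?p - 2"
      using gg by (simp add: G_trivial p algebra_simps del: of_nat_mult)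
    show ?thesis
      unfolding J using 3 by (simp add: G_trivial G'_trivial power2_eq_square algebra_simps)
  qed
qed

section \<open>Determinants of the matrices of Gauss and Jacobi sums\<close>

abbreviation \<eta> :: "nat \<Rightarrow> complex" where "\<eta> t \<equiv> period (g ^ t)"

definition M :: "complex mat" where "M = mat n n (\<lambda>(i, j). G (i + j))"
definition M1 :: "complex mat" where "M1 = mat (n - 1) (n - 1) (\<lambda>(i, j). G (Suc i + Suc j))"
definition M' :: "complex mat" where "M' = mat n n (\<lambda>(i, j). G' (i + j))"
definition M1' :: "complex mat" where "M1' = mat (n - 1) (n - 1) (\<lambda>(i, j). G' (Suc i + Suc j))"

lemma M_eq: "M = hankel_mat n \<omega> \<eta>" and M'_eq: "M' = hankel_mat n (inverse \<omega>) \<eta>"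
  by (simp_all add: M_def M'_def hankel_mat_def G_eq G'_def)

lemma det_M: "det M = (-1) ^ (n * (n - 1) div 2 + (n - 1)) * of_nat n ^ n * (\<Prod>t<n. \<eta> t)"
  unfolding M_eq by (rule det_hankel_mat[OF primitive_\<omega>]) (use n_ge_2 in simp)

lemma det_M': "det M' = det M"
  unfolding det_M M'_eq
  by (rule det_hankel_mat) (use n_ge_2 primitive_\<omega> in \<open>simp_all add: primitive_root_inverse\<close>)

lemma det_M1: "of_nat n ^ 2 * det M1 = det M * (\<Sum>t<n. 1 / \<eta> t)"
  using det_hankel_minor[OF primitive_\<omega>, of \<eta>] n_ge_2
  by (simp add: M1_def M_eq G_eq period_nonzero g_nonzero del: add_Suc add_Suc_right)

lemma det_M1': "det M1' = det M1"
proof -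
  have "of_nat n ^ 2 * det M1' = det M' * (\<Sum>t<n. 1 / \<eta> t)"
    using det_hankel_minor[of n "inverse \<omega>" \<eta>] n_ge_2 primitive_\<omega>
    by (simp add: M1'_def M'_eq G'_def period_nonzero g_nonzero primitive_root_inverse
        del: add_Suc add_Suc_right)
  then have "of_nat n ^ 2 * det M1' = (of_nat n ^ 2 * det M1 :: complex)"
    by (simp add: det_M' det_M1)
  then show ?thesis using n_ge_2 by simp
qed

text \<open>Reversing the index pairs \<open>i\<close> with \<open>n - i\<close>, so the product of
  the \<open>G\<close> equals that of the \<open>G'\<close>. The square becomes a product of terms
  \<open>G i * G' i\<close>, each equal to \<open>\<sigma> ^ i\<close> times
  \<open>p\<close>.\<close>

lemma prod_\<sigma>_G_square:
  "(\<Prod>i<n - 1. \<sigma> ^ Suc i * G (Suc i)) ^ 2 = of_nat CARD('a) ^ (n - 1) * \<sigma> ^ (n * (n - 1) div 2)"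
proof -
  let ?p = "of_nat CARD('a) :: complex"
  have nd: "\<not> n dvd Suc i" if "i < n - 1" for i
    using that by (auto dest: dvd_imp_le)
  have "(\<Prod>i<n - 1. G (Suc i)) = (\<Prod>i<n - 1. G (Suc (n - 1 - Suc i)))"
    by (rule prod.nat_diff_reindex[symmetric])
  also have "\<dots> = (\<Prod>i<n - 1. G' (Suc i))"
  proof (rule prod.cong)
    fix i assume "i \<in> {..<n - 1}"
    then have "Suc i + Suc (n - 1 - Suc i) = n" by simp
    then have "n dvd Suc i + Suc (n - 1 - Suc i)" by (metis dvd_refl)
    then show "G (Suc (n - 1 - Suc i)) = G' (Suc i)" by (rule G'_eq_G[symmetric])
  qed simp
  finally have G': "(\<Prod>i<n - 1. G (Suc i)) = (\<Prod>i<n - 1. G' (Suc i))" .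
  have "(\<Prod>i<n - 1. \<sigma> ^ Suc i * G (Suc i)) ^ 2 =
      (\<Prod>i<n - 1. \<sigma> ^ Suc i) * (\<Prod>i<n - 1. \<sigma> ^ Suc i) *
      ((\<Prod>i<n - 1. G (Suc i)) * (\<Prod>i<n - 1. G' (Suc i)))"
    unfolding G'[symmetric] power2_eq_square prod.distrib by (simp only: ac_simps)
  also have "\<dots> = (\<Prod>i<n - 1. (\<sigma> ^ Suc i * \<sigma> ^ Suc i) * (G (Suc i) * G' (Suc i)))"
    by (simp only: prod.distrib)
  also have "\<dots> = (\<Prod>i<n - 1. \<sigma> ^ Suc i * ?p)"
    by (rule prod.cong[OF refl], subst G_mult_G') (use nd in \<open>auto simp only: \<sigma>_square lessThan_iff mult_1\<close>)
  also have "\<dots> = \<sigma> ^ (\<Sum>i<n - 1. Suc i) * ?p ^ (n - 1)"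
    by (simp only: prod.distrib power_sum prod_constant card_lessThan)
  also have "(\<Sum>i<n - 1. Suc i) = (\<Sum>i<n. i)"
    using sum.lessThan_Suc_shift[of id "n - 1"] n_ge_2 by simp
  also have "\<dots> = n * (n - 1) div 2"
    using Sum_Ico_nat[of 0 n] by (simp add: atLeast0LessThan)
  finally show ?thesis by (simp add: mult.commute)
qed

lemma X_mat_eq: "X_mat \<chi> k n = mat (n - 1) (n - 1) (\<lambda>(i, j). jacobi_sum (\<psi> (Suc i)) (\<psi> (Suc j)))"
  using n_ge_2 by (simp add: X_mat_def mat_from_to_def \<psi>_def)

lemma Y_mat_eq: "Y_mat \<chi> k n = mat n n (\<lambda>(i, j). jacobi_sum (\<psi> i) (\<psi> j))"
  using n_ge_2 by (simp add: Y_mat_def mat_from_to_def \<psi>_def)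

lemma det_X_scaled:
  "of_nat CARD('a) ^ (n - 1) * det (X_mat \<chi> k n) =
    det (mat (n - 1) (n - 1) (\<lambda>(i, j). (\<sigma> ^ Suc i * G (Suc i)) * G' (Suc i + Suc j) * (\<sigma> ^ Suc j * G (Suc j))))"
proof -
  have "of_nat CARD('a) ^ (n - 1) * det (X_mat \<chi> k n) = det (of_nat CARD('a) \<cdot>\<^sub>m X_mat \<chi> k n)"
    by (simp add: det_smult X_mat_eq)
  also have "of_nat CARD('a) \<cdot>\<^sub>m X_mat \<chi> k n =
      mat (n - 1) (n - 1) (\<lambda>(i, j). (\<sigma> ^ Suc i * G (Suc i)) * G' (Suc i + Suc j) * (\<sigma> ^ Suc j * G (Suc j)))"
    by (rule eq_matI) (auto simp: X_mat_eq jacobi_eq simp del: power_Suc add_Suc add_Suc_right)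
  finally show ?thesis .
qed

text \<open>The row and column factors of the scaled Jacobi matrix multiply to the square just
  computed, whose power of \<open>p\<close> cancels the scaling.\<close>

lemma det_X: "det (X_mat \<chi> k n) = \<sigma> ^ (n * (n - 1) div 2) * det M1"
proof -
  have "of_nat CARD('a) ^ (n - 1) * det (X_mat \<chi> k n) =
      (\<Prod>i<n - 1. \<sigma> ^ Suc i * G (Suc i)) ^ 2 * det M1'"
    unfolding det_X_scaled det_mat_scale M1'_def by (simp only: power2_eq_square ac_simps)
  then show ?thesis
    unfolding prod_\<sigma>_G_square det_M1' by simp
qed

text \<open>The corner correction contributes its multiple of the minor, which is the scaled
  \<open>det (X_mat \<chi> k n)\<close>. The factor \<open>G 0 = -1\<close> disappears in the
  square; the scaling is \<open>p ^ n\<close> against \<open>p ^ (n - 1)\<close> from the product,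
  so one \<open>p\<close> survives.\<close>

lemma det_Y:
  "of_nat CARD('a) * det (Y_mat \<chi> k n) =
    \<sigma> ^ (n * (n - 1) div 2) * det M + (of_nat CARD('a) - 1)\<^sup>2 * det (X_mat \<chi> k n)"
proof -
  let ?p = "of_nat CARD('a) :: complex"
  let ?f = "\<lambda>i j. (\<sigma> ^ i * G i) * G' (i + j) * (\<sigma> ^ j * G j)"
  have n: "n = Suc (n - 1)" using n_ge_2 by simp
  then have pn: "?p ^ n = ?p ^ (n - 1) * ?p" by (metis power_Suc2)
  have "?p ^ n * det (Y_mat \<chi> k n) = det (?p \<cdot>\<^sub>m Y_mat \<chi> k n)"
    by (simp add: det_smult Y_mat_eq)
  also have "?p \<cdot>\<^sub>m Y_mat \<chi> k n =
      mat n n (\<lambda>(i, j). ?f i j + (if i = 0 \<and> j = 0 then (?p - 1)\<^sup>2 else 0))"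
    by (rule eq_matI) (auto simp: Y_mat_eq jacobi_eq)
  also have "det \<dots> = det (mat n n (\<lambda>(i, j). ?f i j)) + (?p - 1)\<^sup>2 * (?p ^ (n - 1) * det (X_mat \<chi> k n))"
    unfolding det_X_scaled by (rule det_add_corner) (use n_ge_2 in simp)
  also have "det (mat n n (\<lambda>(i, j). ?f i j)) = (\<Prod>i<n. \<sigma> ^ i * G i) ^ 2 * det M'"
    unfolding det_mat_scale M'_def by (simp only: power2_eq_square ac_simps)
  also have "(\<Prod>i<n. \<sigma> ^ i * G i) = - (\<Prod>i<n - 1. \<sigma> ^ Suc i * G (Suc i))"
    by (subst (1) n, subst prod.lessThan_Suc_shift) (simp add: G_trivial)
  also have "(- (\<Prod>i<n - 1. \<sigma> ^ Suc i * G (Suc i)))\<^sup>2 = ?p ^ (n - 1) * \<sigma> ^ (n * (n - 1) div 2)"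
    by (simp only: power2_minus prod_\<sigma>_G_square)
  finally have "?p ^ (n - 1) * (?p * det (Y_mat \<chi> k n)) = ?p ^ (n - 1) *
      (\<sigma> ^ (n * (n - 1) div 2) * det M + (?p - 1)\<^sup>2 * det (X_mat \<chi> k n))"
    by (simp only: pn det_M' distrib_left ac_simps)
  then show ?thesis by simp
qed

lemma gauss_jacobi_determinants:
  defines "P \<equiv> period_poly TYPE('a) \<zeta> k"
  shows "det M1 = \<sigma> ^ (n * (n - 1) div 2) * det (X_mat \<chi> k n)"
    and "det M1 = (-1) ^ (n * (n - 1) div 2) * of_nat n ^ (n - 2) * of_int (poly.coeff P 1)"
    and "det M = \<sigma> ^ (n * (n - 1) div 2) *
      (of_nat CARD('a) * det (Y_mat \<chi> k n) - (of_nat CARD('a) - 1)\<^sup>2 * det (X_mat \<chi> k n))"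
    and "det M = (-1) ^ (n * (n - 1) div 2 + 1) * of_nat n ^ n * of_int (poly.coeff P 0)"
proof -
  let ?T = "n * (n - 1) div 2" and ?N = "of_nat n :: complex"
  have s: "\<sigma> ^ ?T * (\<sigma> ^ ?T * x) = x" for x
    by (simp add: \<sigma>_square flip: mult.assoc)
  show "det M1 = \<sigma> ^ ?T * det (X_mat \<chi> k n)"
    by (simp only: det_X s)
  show "det M = \<sigma> ^ ?T *
      (of_nat CARD('a) * det (Y_mat \<chi> k n) - (of_nat CARD('a) - 1)\<^sup>2 * det (X_mat \<chi> k n))"
    by (simp only: det_Y add_diff_cancel_right' s)
  \<comment> \<open>Exposes \<open>n ^ n = n ^ 2 * n ^ (n - 2)\<close>; the sign
    \<open>(-1) ^ (n - 1)\<close> of the determinant cancels against that of the linear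
    coefficient.\<close>
  obtain r where n: "n = r + 2" using n_ge_2 by (metis add.commute le_Suc_ex)
  have "?N ^ 2 * det M1 =
      ?N ^ 2 * ((-1) ^ ?T * ?N ^ (n - 2) * of_int (poly.coeff P 1))"
    unfolding det_M1 det_M P_def coeff_period_poly by (simp add: n power_add power2_eq_square)
  then show "det M1 = (-1) ^ ?T * ?N ^ (n - 2) * of_int (poly.coeff P 1)"
    using n_ge_2 by simp
  show "det M = (-1) ^ (?T + 1) * ?N ^ n * of_int (poly.coeff P 0)"
    unfolding det_M P_def coeff_period_poly by (simp add: n power_add)
qed

end

theorem theorem1p2:
  fixes \<chi> :: "'p::prime_card mod_ring \<Rightarrow> complex"
    and \<zeta> :: complex
    and p k n :: nat
    and P :: "int poly"
  assumes "p = CARD('p)"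
    and "1 \<le> k" and "k < p - 1" and "k dvd p - 1" and "p - 1 = k * n"
    and "char_generator \<chi>"
    and "primitive_root_of_unity p \<zeta>"
    and "P = period_poly TYPE('p) \<zeta> k"
  shows
    "(det (mat_from_to 1 (n - 1) (\<lambda>i j. gauss_sum \<zeta> (char_pow \<chi> (k * i + k * j))))
        = (-1) ^ (k * (n\<^sup>2 - n) div 2) * det (X_mat \<chi> k n)
      \<and> (-1) ^ (k * (n\<^sup>2 - n) div 2) * det (X_mat \<chi> k n)
        = (-1) ^ ((n\<^sup>2 - n) div 2) * of_nat n ^ (n - 2) * of_int (poly.coeff P 1))
     \<and> (det (mat_from_to 0 (n - 1) (\<lambda>i j. gauss_sum \<zeta> (char_pow \<chi> (k * i + k * j))))
        = (-1) ^ (k * (n\<^sup>2 - n) div 2) *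
            (of_nat p * det (Y_mat \<chi> k n) - (of_nat p - 1)\<^sup>2 * det (X_mat \<chi> k n))
      \<and> (-1) ^ (k * (n\<^sup>2 - n) div 2) *
            (of_nat p * det (Y_mat \<chi> k n) - (of_nat p - 1)\<^sup>2 * det (X_mat \<chi> k n))
        = (-1) ^ ((n\<^sup>2 - n + 2) div 2) * of_nat n ^ n * of_int (poly.coeff P 0))"
proof -
  \<comment> \<open>The bound \<open>k < p - 1\<close> excludes both \<open>n = 0\<close> and
    \<open>n = 1\<close>.\<close>
  have n2: "n \<ge> 2"
  proof (rule ccontr)
    assume "\<not> ?thesis"
    then have "n = 0 \<or> n = 1" by auto
    then show False using assms(2,3,5) by auto
  qed
  obtain g :: "'p mod_ring" where g: "g \<noteq> 0" "\<And>x. x \<noteq> 0 \<Longrightarrow> \<exists>j::nat. x = g ^ j"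
    by (rule ex_mod_ring_generator) blast
  have "\<zeta> \<noteq> 1"
    using assms(3,7) by (auto simp: primitive_root_of_unity_def dest: spec[of _ 1])
  then interpret gauss_characters g \<zeta> k n \<chi>
    using assms g n2 by unfold_locales (auto simp: primitive_root_of_unity_def)
  have T: "n * (n - 1) div 2 = (n\<^sup>2 - n) div 2"
    by (simp add: power2_eq_square right_diff_distrib')
  \<comment> \<open>In the theorem the division by 2 applies to the whole product with
    \<open>k\<close>; evenness allows \<open>k\<close> to be moved out of it.\<close>
  have "even (n\<^sup>2 - n)"
    using n2 by (simp add: power2_eq_square)
  then have s: "\<sigma> ^ ((n\<^sup>2 - n) div 2) = (-1) ^ (k * (n\<^sup>2 - n) div 2)"
    by (simp add: \<sigma>_def div_mult_swap flip: power_mult)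
  have M: "M = mat_from_to 0 (n - 1) (\<lambda>i j. gauss_sum \<zeta> (char_pow \<chi> (k * i + k * j)))"
    using n2 by (simp add: M_def mat_from_to_def G_def \<psi>_def distrib_left)
  have M1: "M1 = mat_from_to 1 (n - 1) (\<lambda>i j. gauss_sum \<zeta> (char_pow \<chi> (k * i + k * j)))"
    using n2 by (simp add: M1_def mat_from_to_def G_def \<psi>_def distrib_left del: add_Suc_right add_Suc)
  have T1: "(n\<^sup>2 - n + 2) div 2 = (n\<^sup>2 - n) div 2 + 1" by simp
  note det = gauss_jacobi_determinants[unfolded T s, folded assms(1,8)]
  show ?thesis
    unfolding T1 M[symmetric] M1[symmetric] using det by metis
qed

end
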